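(* Let $n\in\mathbb{N}$, $n\ge 1$. The holomorphic function spaces $\mathfrak{F}_1$ and $\mathfrak{F}_2$ (with inner products $\langle\cdot,\cdot\rangle_1$ and $\langle\cdot,\cdot\rangle_2$) are reproducing kernel Hilbert spaces of functions on $\mathbb{C}$, with respective reproducing kernels $F_w$ and $\widetilde{F}_w$ ($w\in\mathbb{C}$) given by $$F_w(z)=\sum_{l=0}^{\infty} e_l(z)\overline{e_l(w)},\qquad \widetilde{F}_w(z)=\sum_{l=0}^{\infty}\widetilde{e}_l(z)\overline{\widetilde{e}_l(w)},\qquad z\in\mathbb{C}.$$
   Context: Fix an integer $n\ge 1$. Let $\mathrm{d}A$ be Lebesgue measure on $\mathbb{C}$ and let $K_\nu$ be the modified Bessel function of the second kind, $K_\nu(x)=\int_0^\infty e^{-x\cosh t}\cosh(\nu t)\,\mathrm{d}t$ for $x>0$. Define the weights $$\rho_1(z,\bar z)=\frac{2}{(2n)^{\frac{1}{2n}}\pi\,\Gamma\big(\frac{1}{2n}\big)}(z\bar z)^{n-\frac12}K_{1-\frac{1}{2n}}\Big(\frac{(z\bar z)^n}{n}\Big),\qquad \rho_2(z,\bar z)=\frac{2}{(2n)^{\frac{1}{2n}}\pi\,\Gamma\big(\frac{1}{2n}\big)}(z\bar z)^{n-\frac12}K_{\frac{1}{2n}}\Big(\frac{(z\bar z)^n}{n}\Big),$$ and the inner products $\langle f,g\rangle_j=\int_{\mathbb{C}}f(z)\overline{g(z)}\rho_j(z,\bar z)\,\mathrm{d}A(z)$, $j=1,2$. For $k=0,1,2,\ldots$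 define $$e_{2k}(z)=\sqrt{\frac{\Gamma(\frac{1}{2n})}{(2n)^{2k}\,\Gamma(k+\frac{1}{2n})\,k!}}\;z^{2nk},\qquad e_{2k+1}(z)=\sqrt{\frac{\Gamma(\frac{1}{2n})}{(2n)^{2k+2-\frac1n}\,\Gamma(k+2-\frac{1}{2n})\,k!}}\;z^{2nk+2n-1},$$ $$\widetilde e_{2k}(z)=\sqrt{\frac{\Gamma(\frac{1}{2n})}{(2n)^{2k+1-\frac1n}\,\Gamma(k+1-\frac{1}{2n})\,k!}}\;z^{2nk+n-1},\qquad \widetilde e_{2k+1}(z)=\sqrt{\frac{\Gamma(\frac{1}{2n})}{(2n)^{2k+1}\,\Gamma(k+1+\frac{1}{2n})\,k!}}\;z^{2nk+n}.$$ The spaces (of entire functions) are $$\mathfrak{F}_1=\Big\{\sum_{l\ge0}c_le_l\;:\;c_l\in\mathbb{C},\ \sum_l|c_l|^2<\infty\Big\},\qquad \mathfrak{F}_2=\Big\{\sum_{l\ge0}d_l\widetilde e_l\;:\;d_l\in\mathbb{C},\ \sum_l|d_l|^2<\infty\Big\},$$ equipped with $\langle\cdot,\cdot\rangle_1$ and $\langle\cdot,\cdot\rangle_2$ respectively. A vector subspace $\mathfrak{H}$ of the complex-valued functions on a set $X$ with a Hilbert space structure is a reproducing kernel Hilbert space if for every $x\in X$ evaluation at $x$ is a continuous linear functional on $\mathfrak{H}$; the function $f_x\in\mathfrak{H}$ satisfying $\langle h,f_x\rangle=h(x)$ for all $h\in\mathfrak{H}$, $x\in X$ is called the reproducing kernel.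 Inner products are linear in the first argument. *)

theory Defs
  imports "HOL-Analysis.Analysis"
begin

section \<open>Hilbert spaces of functions and reproducing kernels\<close>

definition fun_subspace :: "('x \<Rightarrow> complex) set \<Rightarrow> bool" where
  "fun_subspace H \<longleftrightarrow>
     (\<lambda>x. 0) \<in> H \<and>
     (\<forall>f\<in>H. \<forall>g\<in>H. (\<lambda>x. f x + g x) \<in> H) \<and>
     (\<forall>c. \<forall>f\<in>H. (\<lambda>x. c * f x) \<in> H)"

definition inner_product_on ::
    "('x \<Rightarrow> complex) set \<Rightarrow> (('x \<Rightarrow> complex) \<Rightarrow> ('x \<Rightarrow> complex) \<Rightarrow> complex) \<Rightarrow> bool" where
  "inner_product_on H ip \<longleftrightarrow>
     (\<forall>f\<in>H. \<forall>g\<in>H. \<forall>h\<in>H. ip (\<lambda>x. f x + g x) h = ip f h + ip g h) \<and>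
     (\<forall>c. \<forall>f\<in>H. \<forall>h\<in>H. ip (\<lambda>x. c * f x) h = c * ip f h) \<and>
     (\<forall>f\<in>H. \<forall>g\<in>H. ip g f = cnj (ip f g)) \<and>
     (\<forall>f\<in>H. 0 \<le> Re (ip f f)) \<and>
     (\<forall>f\<in>H. ip f f = 0 \<longrightarrow> f = (\<lambda>x. 0))"

text \<open>
  The library's metric spaces on a carrier require nonnegativity and symmetry of the distance
  off the carrier as well, hence the value 0 there.
\<close>

definition ip_dist ::
    "('x \<Rightarrow> complex) set \<Rightarrow> (('x \<Rightarrow> complex) \<Rightarrow> ('x \<Rightarrow> complex) \<Rightarrow> complex)
       \<Rightarrow> ('x \<Rightarrow> complex) \<Rightarrow> ('x \<Rightarrow> complex) \<Rightarrow> real" where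
  "ip_dist H ip f g =
     (if f \<in> H \<and> g \<in> H then sqrt (Re (ip (\<lambda>x. f x - g x) (\<lambda>x. f x - g x))) else 0)"

definition function_hilbert_space ::
    "('x \<Rightarrow> complex) set \<Rightarrow> (('x \<Rightarrow> complex) \<Rightarrow> ('x \<Rightarrow> complex) \<Rightarrow> complex) \<Rightarrow> bool" where
  "function_hilbert_space H ip \<longleftrightarrow>
     fun_subspace H \<and> inner_product_on H ip \<and> Metric_space.mcomplete H (ip_dist H ip)"

definition rkhs ::
    "('x \<Rightarrow> complex) set \<Rightarrow> (('x \<Rightarrow> complex) \<Rightarrow> ('x \<Rightarrow> complex) \<Rightarrow> complex) \<Rightarrow> bool" where
  "rkhs H ip \<longleftrightarrow>
     function_hilbert_space H ip \<and>
     (\<forall>x. continuous_map (Metric_space.mtopology H (ip_dist H ip)) euclidean (\<lambda>f. f x))"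

definition reproducing_kernel ::
    "('x \<Rightarrow> complex) set \<Rightarrow> (('x \<Rightarrow> complex) \<Rightarrow> ('x \<Rightarrow> complex) \<Rightarrow> complex)
       \<Rightarrow> ('x \<Rightarrow> 'x \<Rightarrow> complex) \<Rightarrow> bool" where
  "reproducing_kernel H ip F \<longleftrightarrow>
     (\<forall>w. F w \<in> H) \<and> (\<forall>w. \<forall>h\<in>H. ip h (F w) = h w)"

text \<open>The distance of an inner product is a metric in the sense of the library.\<close>

lemma Metric_space_ip_dist:
  assumes S: "fun_subspace H" and I: "inner_product_on H ip"
  shows "Metric_space H (ip_dist H ip)"
proof -
  let ?z = "\<lambda>x. 0 :: complex"
  have add: "(\<lambda>x. f x + g x) \<in> H" if "f \<in> H" "g \<in> H" for f g
    using S that by (auto simp: fun_subspace_def)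
  have scale: "(\<lambda>x. c * f x) \<in> H" if "f \<in> H" for f c
    using S that by (auto simp: fun_subspace_def)
  have diff: "(\<lambda>x. f x - g x) \<in> H" if "f \<in> H" "g \<in> H" for f g
    using add[OF that(1) scale[OF that(2), of "-1"]] by simp
  have ladd: "ip (\<lambda>x. f x + g x) h = ip f h + ip g h" if "f \<in> H" "g \<in> H" "h \<in> H" for f g h
    using I that unfolding inner_product_on_def by blast
  have lscale: "ip (\<lambda>x. c * f x) h = c * ip f h" if "f \<in> H" "h \<in> H" for c f h
    using I that unfolding inner_product_on_def by blast
  have sym: "ip g f = cnj (ip f g)" if "f \<in> H" "g \<in> H" for f g
    using I that unfolding inner_product_on_def by blast
  have nn: "0 \<le> Re (ip f f)" if "f \<in> H" for f
    using I that unfolding inner_product_on_def by blast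
  have pd: "f = ?z" if "f \<in> H" "ip f f = 0" for f
    using I that unfolding inner_product_on_def by blast
  have real: "Im (ip f f) = 0" if "f \<in> H" for f
    using arg_cong[OF sym[OF that that], of Im] by simp
  have pd': "f = ?z" if "f \<in> H" "Re (ip f f) = 0" for f
    using pd[OF that(1)] real[OF that(1)] that(2) by (simp add: complex_eq_iff)
  have radd: "ip h (\<lambda>x. f x + g x) = ip h f + ip h g" if "f \<in> H" "g \<in> H" "h \<in> H" for f g h
    using sym[OF add[OF that(1,2)] that(3)] sym[OF that(1,3)] sym[OF that(2,3)] ladd[OF that]
    by simp
  have rscale: "ip h (\<lambda>x. c * f x) = cnj c * ip h f" if "f \<in> H" "h \<in> H" for c f h
    using sym[OF scale[OF that(1), of c] that(2)] sym[OF that] lscale[OF that, of c] by simp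
  have expand: "Re (ip (\<lambda>x. f x + g x) (\<lambda>x. f x + g x)) =
      Re (ip f f) + 2 * Re (ip f g) + Re (ip g g)" if "f \<in> H" "g \<in> H" for f g
    using ladd[OF that add[OF that]] radd[OF that that(1)] radd[OF that that(2)] sym[OF that]
    by simp
  have CS: "\<bar>Re (ip f g)\<bar> \<le> sqrt (Re (ip f f)) * sqrt (Re (ip g g))"
    if fg: "f \<in> H" "g \<in> H" for f g
  proof (cases "Re (ip g g) = 0")
    case True
    then have "g = (\<lambda>x. 0 * f x)" using pd'[OF fg(2)] by simp
    then have "ip f g = 0" using rscale[OF fg(1) fg(1), of 0] by simp
    then show ?thesis using nn[OF fg(1)] nn[OF fg(2)] by simp
  next
    case False
    let ?a = "Re (ip f f)" and ?b = "Re (ip f g)" and ?c = "Re (ip g g)"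
    have c: "?c > 0" using False nn[OF fg(2)] by simp
    define t where "t = ?b / ?c"
    let ?h = "\<lambda>x. complex_of_real (- t) * g x"
    have h: "?h \<in> H" using scale[OF fg(2)] .
    have "0 \<le> Re (ip (\<lambda>x. f x + ?h x) (\<lambda>x. f x + ?h x))"
      using nn[OF add[OF fg(1) h]] .
    also have "\<dots> = ?a + 2 * Re (ip f ?h) + Re (ip ?h ?h)"
      using expand[OF fg(1) h] .
    also have "ip f ?h = complex_of_real (- t) * ip f g"
      using rscale[OF fg(2,1), of "complex_of_real (- t)"] by simp
    also have "ip ?h ?h = complex_of_real (- t) * (complex_of_real (- t) * ip g g)"
      using lscale[OF fg(2) h, of "complex_of_real (- t)"]
        rscale[OF fg(2) fg(2), of "complex_of_real (- t)"] by simp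
    finally have "0 \<le> ?a - 2 * t * ?b + t * t * ?c" by simp
    also have "\<dots> = ?a - ?b * ?b / ?c" using c by (simp add: t_def field_simps)
    finally have "?b\<^sup>2 \<le> ?a * ?c" using c by (simp add: field_simps power2_eq_square)
    then have "sqrt (?b\<^sup>2) \<le> sqrt (?a * ?c)" by (rule real_sqrt_le_mono)
    then show ?thesis by (simp add: real_sqrt_mult)
  qed
  have tri: "sqrt (Re (ip (\<lambda>x. f x + g x) (\<lambda>x. f x + g x)))
      \<le> sqrt (Re (ip f f)) + sqrt (Re (ip g g))" if fg: "f \<in> H" "g \<in> H" for f g
  proof (rule real_le_lsqrt)
    show "0 \<le> sqrt (Re (ip f f)) + sqrt (Re (ip g g))"
      using nn[OF fg(1)] nn[OF fg(2)] by simp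
    show "Re (ip (\<lambda>x. f x + g x) (\<lambda>x. f x + g x))
        \<le> (sqrt (Re (ip f f)) + sqrt (Re (ip g g)))\<^sup>2"
      using expand[OF fg] CS[OF fg] nn[OF fg(1)] nn[OF fg(2)] by (simp add: power2_sum)
  qed
  show ?thesis
  proof
    show "0 \<le> ip_dist H ip f g" for f g
      using nn[OF diff] by (simp add: ip_dist_def)
    show "ip_dist H ip f g = ip_dist H ip g f" for f g
    proof (cases "f \<in> H \<and> g \<in> H")
      case True
      then have d: "(\<lambda>x. g x - f x) \<in> H" using diff by blast
      have m: "(\<lambda>x. -1 * (g x - f x)) \<in> H" using scale[OF d, of "-1"] .
      have "ip (\<lambda>x. -1 * (g x - f x)) (\<lambda>x. -1 * (g x - f x)) =
          ip (\<lambda>x. g x - f x) (\<lambda>x. g x - f x)"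
        using lscale[OF d m, of "-1"] rscale[OF d d, of "-1"] by simp
      then show ?thesis using True by (simp add: ip_dist_def)
    qed (auto simp: ip_dist_def)
    show "ip_dist H ip f g = 0 \<longleftrightarrow> f = g" if fg: "f \<in> H" "g \<in> H" for f g
    proof
      assume "ip_dist H ip f g = 0"
      then have "(\<lambda>x. f x - g x) = ?z"
        using fg pd'[OF diff[OF fg]] by (simp add: ip_dist_def)
      then show "f = g" by (auto simp: fun_eq_iff)
    next
      assume "f = g"
      moreover have "ip ?z ?z = 0" using lscale[OF fg(1) scale[OF fg(1), of 0], of 0] by simp
      ultimately show "ip_dist H ip f g = 0" by (simp add: ip_dist_def)
    qed
    show "ip_dist H ip f h \<le> ip_dist H ip f g + ip_dist H ip g h"
      if "f \<in> H" "g \<in> H" "h \<in> H" for f g h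
      using tri[OF diff[OF that(1,2)] diff[OF that(2,3)]] that by (simp add: ip_dist_def)
  qed
qed

section \<open>The weights\<close>

definition bessel_K :: "real \<Rightarrow> real \<Rightarrow> real" where
  "bessel_K \<nu> x = (LBINT t:{0..}. exp (- x * cosh t) * cosh (\<nu> * t))"

text \<open>
  Here \<open>z * cnj z\<close> appears as the real number \<open>(cmod z)\<^sup>2\<close>. The value at
  \<open>z = 0\<close> is irrelevant, a single point being a null set.
\<close>

definition rho1 :: "nat \<Rightarrow> complex \<Rightarrow> real" where
  "rho1 n z =
     2 / ((2 * real n) powr (1 / (2 * real n)) * pi * Gamma (1 / (2 * real n)))
     * ((cmod z)\<^sup>2) powr (real n - 1 / 2)
     * bessel_K (1 - 1 / (2 * real n)) (((cmod z)\<^sup>2) ^ n / real n)"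

definition rho2 :: "nat \<Rightarrow> complex \<Rightarrow> real" where
  "rho2 n z =
     2 / ((2 * real n) powr (1 / (2 * real n)) * pi * Gamma (1 / (2 * real n)))
     * ((cmod z)\<^sup>2) powr (real n - 1 / 2)
     * bessel_K (1 / (2 * real n)) (((cmod z)\<^sup>2) ^ n / real n)"

definition weighted_ip ::
    "(complex \<Rightarrow> real) \<Rightarrow> (complex \<Rightarrow> complex) \<Rightarrow> (complex \<Rightarrow> complex) \<Rightarrow> complex" where
  "weighted_ip \<rho> f g = (LINT z|lborel. f z * cnj (g z) * complex_of_real (\<rho> z))"

section \<open>The two spaces\<close>

definition e_fun :: "nat \<Rightarrow> nat \<Rightarrow> complex \<Rightarrow> complex" where
  "e_fun n l z =
    (let k = l div 2 in
     if even l then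
       complex_of_real (sqrt (Gamma (1 / (2 * real n)) /
         ((2 * real n) ^ (2 * k) * Gamma (real k + 1 / (2 * real n)) * fact k)))
       * z ^ (2 * n * k)
     else
       complex_of_real (sqrt (Gamma (1 / (2 * real n)) /
         ((2 * real n) powr (2 * real k + 2 - 1 / real n)
          * Gamma (real k + 2 - 1 / (2 * real n)) * fact k)))
       * z ^ (2 * n * k + 2 * n - 1))"

definition et_fun :: "nat \<Rightarrow> nat \<Rightarrow> complex \<Rightarrow> complex" where
  "et_fun n l z =
    (let k = l div 2 in
     if even l then
       complex_of_real (sqrt (Gamma (1 / (2 * real n)) /
         ((2 * real n) powr (2 * real k + 1 - 1 / real n)
          * Gamma (real k + 1 - 1 / (2 * real n)) * fact k)))
       * z ^ (2 * n * k + n - 1)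
     else
       complex_of_real (sqrt (Gamma (1 / (2 * real n)) /
         ((2 * real n) ^ (2 * k + 1) * Gamma (real k + 1 + 1 / (2 * real n)) * fact k)))
       * z ^ (2 * n * k + n))"

text \<open>Series of functions are understood pointwise.\<close>

definition l2_series_space :: "(nat \<Rightarrow> complex \<Rightarrow> complex) \<Rightarrow> (complex \<Rightarrow> complex) set" where
  "l2_series_space e =
     {f. \<exists>c :: nat \<Rightarrow> complex. summable (\<lambda>l. (cmod (c l))\<^sup>2) \<and>
           (\<forall>z. (\<lambda>l. c l * e l z) sums f z)}"

definition F1 :: "nat \<Rightarrow> (complex \<Rightarrow> complex) set" where
  "F1 n = l2_series_space (e_fun n)"

definition F2 :: "nat \<Rightarrow> (complex \<Rightarrow> complex) set" where
  "F2 n = l2_series_space (et_fun n)"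

end

theory Submission
  imports Defs "HOL-Complex_Analysis.Complex_Analysis"
begin

text \<open>
  The square norms of monomials with respect to a radial weight are radial moments. For the Bessel
  weights these are Mellin transforms of \<open>K\<^sub>\<nu>\<close>, which Fubini's theorem factors into a Gamma integral
  and, after substituting \<open>x = e\<^sup>t / (2 cosh t)\<close>, a Beta integral; the result is exactly the normalising
  constant of \<open>e\<^sub>l\<close>. Rotation invariance makes distinct monomials orthogonal. A Fatou argument then gives
  \<open>\<langle>\<Sum> c\<^sub>l e\<^sub>l, \<Sum> d\<^sub>l e\<^sub>l\<rangle> = \<Sum> c\<^sub>l cnj d\<^sub>l\<close>, so the spaces are isometric copies of square summable
  sequences, and evaluation at \<open>w\<close> is the inner product with the square summable sequence
  \<open>cnj (e\<^sub>l w)\<close>.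
\<close>

section \<open>Lebesgue measure on the complex plane in polar form\<close>

text \<open>The Mellin transform of K_\<nu> at \<mu> is 2^(\<mu> - 2) Gamma a Gamma b, where a + b =
  \<mu> and a - b = \<nu>. A weight fixes the order \<nu>, and the degree m of a monomial then fixes
  a + b = (m + n + 1/2) / n. The degrees occurring in a basis are exactly those for which a or b is
  a positive integer k + 1, so that one Gamma factor is k!. This is why each basis interleaves two
  progressions of degrees with step 2n, and why all four families of constants are instances of one
  statement in a and b. The main obstacle is that elements of the spaces are given only as pointwise
  convergent series, whereas the inner product is an integral over the plane; convergence in mean
  has to be derived. Square summability of the values e_l(z) at each fixed z serves three purposes:
  it makes the series converge, it bounds evaluation at z, and it supplies the locally uniform
  domination behind holomorphy.\<close>

lemma distr_lborel_orthogonal_transformation: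
  fixes f :: "real ^ 'n :: {finite, wellorder} \<Rightarrow> real ^ 'n :: _"
  assumes f: "orthogonal_transformation f"
  shows "distr lborel borel f = lborel"
proof (rule lborel_eqI[symmetric])
  have lin: "linear f" and bij: "bij f"
    using f by (auto intro: orthogonal_transformation_linear orthogonal_transformation_bij)
  have [measurable]: "f \<in> borel_measurable borel"
    using lin by (intro borel_measurable_continuous_onI linear_continuous_on) (simp add: linear_conv_bounded_linear)
  fix l u :: "real ^ 'n :: _" assume lu: "\<And>b. b \<in> Basis \<Longrightarrow> l \<bullet> b \<le> u \<bullet> b"
  have g: "orthogonal_transformation (inv f)"
    using f by (rule orthogonal_transformation_inv)
  \<comment> \<open>The inverse is orthogonal as well, so the preimage of a box has the volume of
    the box, and volumes of boxes determine \<open>lborel\<close>.\<close>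
  have vim: "f -` box l u = inv f ` box l u"
    using bij by (simp add: bij_vimage_eq_inv_image)
  have box: "box l u \<in> lmeasurable" by simp
  have "emeasure (distr lborel borel f) (box l u) = emeasure lborel (f -` box l u)"
    by (simp add: emeasure_distr)
  also have "\<dots> = emeasure lebesgue (inv f ` box l u)"
    using vim measurable_sets_borel[of f borel "box l u"] by simp
  also have "\<dots> = ennreal (measure lebesgue (box l u))"
    using measurable_orthogonal_image[OF g box] measure_orthogonal_image[OF g box]
    by (simp add: emeasure_eq_measure2)
  also have "\<dots> = (\<Prod>b\<in>Basis. (u - l) \<bullet> b)"
    using lu by (simp add: measure_lborel_box_eq)
  finally show "emeasure (distr lborel borel f) (box l u) = (\<Prod>b\<in>Basis. (u - l) \<bullet> b)" .
qed simp

text \<open>Carries orthogonal invariance from \<open>real ^ 2\<close> over to the complex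
  plane.\<close>

lemma distr_lborel_Complex_vec:
  "distr lborel borel (\<lambda>x :: real ^ 2. Complex (x $ 1) (x $ 2)) = lborel"
proof (rule lborel_eqI[symmetric])
  let ?f = "\<lambda>x :: real ^ 2. Complex (x $ 1) (x $ 2)"
  have [measurable]: "?f \<in> borel_measurable borel"
    by (intro borel_measurable_continuous_onI) (auto simp: Complex_eq intro!: continuous_intros)
  fix l u :: complex assume lu: "\<And>b. b \<in> Basis \<Longrightarrow> l \<bullet> b \<le> u \<bullet> b"
  have "?f -` box l u = box (vector [Re l, Im l]) (vector [Re u, Im u])"
    by (auto simp: mem_box_cart forall_2 in_box_complex_iff)
  then have "emeasure (distr lborel borel ?f) (box l u)
      = emeasure lborel (box (vector [Re l, Im l] :: real^2) (vector [Re u, Im u]))"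
    by (simp add: emeasure_distr)
  also have "\<dots> = ennreal ((Re u - Re l) * (Im u - Im l))"
    using lu[of 1] lu[of \<i>] by (subst emeasure_lborel_box_eq)
      (auto simp: Basis_vec_def Basis_complex_def inner_axis UNIV_2 axis_eq_axis)
  also have "\<dots> = (\<Prod>b\<in>Basis. (u - l) \<bullet> b)"
    by (simp add: Basis_complex_def)
  finally show "emeasure (distr lborel borel ?f) (box l u) = (\<Prod>b\<in>Basis. (u - l) \<bullet> b)" .
qed simp

text \<open>In real coordinates, multiplication by a complex number of modulus 1 is linear and norm
  preserving, hence orthogonal.\<close>

lemma distr_lborel_complex_rotation:
  assumes w: "cmod w = 1"
  shows "distr lborel borel ((*) w) = lborel"
proof -
  let ?f = "\<lambda>x :: real ^ 2. Complex (x $ 1) (x $ 2)"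
  define g :: "real ^ 2 \<Rightarrow> real ^ 2" where
    "g x = vector [Re (w * ?f x), Im (w * ?f x)]" for x
  have fm [measurable]: "?f \<in> borel_measurable borel"
    by (intro borel_measurable_continuous_onI) (auto simp: Complex_eq intro!: continuous_intros)
  have norm: "norm x = cmod (?f x)" for x
    by (simp add: norm_vec_def L2_set_def UNIV_2 cmod_def)
  have fg: "?f (g x) = w * ?f x" for x
    by (simp add: g_def complex_eq_iff)
  have "linear g"
    by (rule linearI) (auto simp: g_def vec_eq_iff forall_2 algebra_simps)
  moreover have "norm (g x) = norm x" for x
    using w by (simp only: norm fg norm_mult)
  ultimately have g: "orthogonal_transformation g"
    by (simp add: orthogonal_transformation)
  then have "linear g" by (rule orthogonal_transformation_linear)
  then have gm [measurable]: "g \<in> borel_measurable borel"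
    by (intro borel_measurable_continuous_onI linear_continuous_on) (simp add: linear_conv_bounded_linear)
  have "distr lborel borel ((*) w) = distr (distr lborel borel ?f) borel ((*) w)"
    by (simp only: distr_lborel_Complex_vec)
  also have "\<dots> = distr lborel borel (?f \<circ> g)"
    by (subst distr_distr) (auto simp: o_def fg)
  also have "\<dots> = distr (distr lborel borel g) borel ?f"
    by (subst distr_distr) (auto)
  also have "\<dots> = lborel"
    by (simp only: distr_lborel_orthogonal_transformation[OF g] distr_lborel_Complex_vec)
  finally show ?thesis .
qed

text \<open>A disc of squared radius u has area pi u, which is linear in u. Using the squared
  modulus instead of the modulus thus makes the density constant and leaves no Jacobian factor in
  the moments.\<close>

lemma distr_lborel_cmod_square:
  "distr lborel borel (\<lambda>z. (cmod z)\<^sup>2) = density lborel (\<lambda>u. ennreal (pi * indicator {0..} u))"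
    (is "?M = ?N")
proof (rule measure_eqI_generator_eq[where E = "range atMost" and \<Omega> = UNIV and A = "\<lambda>i. {..real i}"])
  show "Int_stable (range atMost :: real set set)"
    by (auto simp: Int_stable_def)
  show "sets ?M = sigma_sets UNIV (range atMost)" "sets ?N = sigma_sets UNIV (range atMost)"
    by (simp_all add: borel_eq_atMost full_SetCompr_eq[symmetric])
  show "range (\<lambda>i. {..real i}) \<subseteq> range atMost" by auto
  show "(\<Union>i. {..real i}) = UNIV" using real_arch_simple by auto
  have eq: "emeasure ?M {..x} = ennreal (pi * max 0 x)" for x
  proof -
    have "(\<lambda>z. (cmod z)\<^sup>2) -` {..x} = (if x \<ge> 0 then cball 0 (sqrt x) else {})"
      by (auto simp: dist_norm real_le_rsqrt sqrt_ge_absD intro: order_trans[OF zero_le_power2])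
    then show ?thesis
      by (simp add: emeasure_distr emeasure_cball unit_ball_vol_2)
  qed
  show "emeasure ?M {..real i} \<noteq> \<infinity>" for i by (simp add: eq)
  fix X :: "real set" assume "X \<in> range atMost"
  then obtain x where X: "X = {..x}" by auto
  have "emeasure ?N {..x} = (\<integral>\<^sup>+u. ennreal pi * indicator {0..x} u \<partial>lborel)"
    by (subst emeasure_density) (auto intro!: nn_integral_cong split: split_indicator)
  also have "\<dots> = ennreal (pi * max 0 x)"
    by (simp add: nn_integral_cmult_indicator ennreal_mult' emeasure_lborel_Icc_eq max_def)
  finally show "emeasure ?M X = emeasure ?N X" by (simp add: X eq)
qed auto

section \<open>Mellin transforms of Bessel functions\<close>

text \<open>For nonnegative functions integrability and absolute integrability coincide. The change
  of variables for absolutely integrable functions therefore becomes an equivalence that transfers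
  existence and value in both directions, also on open or unbounded domains.\<close>

lemma has_integral_substitution_nonneg:
  fixes f g g' :: "real \<Rightarrow> real"
  assumes "S \<in> sets lebesgue"
    and "\<And>x. x \<in> S \<Longrightarrow> (g has_field_derivative g' x) (at x within S)"
    and "inj_on g S"
    and nonneg: "\<And>x. x \<in> S \<Longrightarrow> 0 \<le> f (g x)"
  shows "((\<lambda>x. \<bar>g' x\<bar> * f (g x)) has_integral b) S \<longleftrightarrow> (f has_integral b) (g ` S)"
proof -
  have *: "(h has_integral b) T \<longleftrightarrow> h absolutely_integrable_on T \<and> integral T h = b"
    if "\<And>x. x \<in> T \<Longrightarrow> 0 \<le> h x" for h :: "real \<Rightarrow> real" and T
    using that nonnegative_absolutely_integrable_1[of h T]
    by (auto simp: has_integral_iff dest: set_lebesgue_integral_eq_integral(1))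
  show ?thesis
    using has_absolute_integral_change_of_variables_1'[OF assms(1-3), of f b] nonneg
    by (subst (1 2) *) auto
qed

text \<open>Substitutions are carried out with the gauge integral, Fubini's theorem and densities
  with the Lebesgue integral; nonnegativity allows passing between them.\<close>

lemma has_bochner_integral_iff_has_integral_nonneg:
  fixes f :: "real \<Rightarrow> real"
  assumes f [measurable]: "f \<in> borel_measurable borel" and S [measurable]: "S \<in> sets borel"
    and nonneg: "\<And>x. x \<in> S \<Longrightarrow> 0 \<le> f x"
  shows "has_bochner_integral lborel (\<lambda>x. indicator S x * f x) b \<longleftrightarrow> (f has_integral b) S"
proof
  assume "has_bochner_integral lborel (\<lambda>x. indicator S x * f x) b"
  then have "((\<lambda>x. indicator S x * f x) has_integral b) UNIV"
    using has_integral_integral_lborel[of "\<lambda>x. indicator S x * f x"]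
    by (auto simp: has_bochner_integral_iff)
  moreover have "(\<lambda>x. indicator S x * f x) = (\<lambda>x. if x \<in> S then f x else 0)"
    by (auto simp: fun_eq_iff)
  ultimately show "(f has_integral b) S"
    by (simp add: has_integral_restrict_UNIV)
next
  assume f: "(f has_integral b) S"
  then have b: "0 \<le> b" using nonneg by (rule has_integral_nonneg)
  have "(\<integral>\<^sup>+x. indicator S x * f x \<partial>lborel) = b"
    by (rule nn_integral_has_integral_lebesgue[OF nonneg f])
  then show "has_bochner_integral lborel (\<lambda>x. indicator S x * f x) b"
    using nonneg b by (intro has_bochner_integral_nn_integral) (auto simp: indicator_def)
qed

lemma has_integral_half_line_even:
  fixes f :: "real \<Rightarrow> real"
  assumes f: "(f has_integral 2 * b) UNIV" and even: "\<And>x. f (- x) = f x" and nonneg: "\<And>x. 0 \<le> f x"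
  shows "(f has_integral b) {0..}"
proof -
  have "f absolutely_integrable_on UNIV"
    using f nonneg by (intro nonnegative_absolutely_integrable_1) auto
  then have "f absolutely_integrable_on {0..}"
    by (rule set_integrable_subset) auto
  then obtain c where c: "(f has_integral c) {0..}"
    by (meson integrable_on_def set_lebesgue_integral_eq_integral(1))
  have "((\<lambda>x. \<bar>-1\<bar> * f (- x)) has_integral c) {0..} \<longleftrightarrow> (f has_integral c) (uminus ` {0..})"
    using nonneg by (intro has_integral_substitution_nonneg) (auto intro!: derivative_eq_intros)
  then have "(f has_integral c) {..0}"
    using c even by simp
  then have "(f has_integral c + c) ({..0} \<union> {0..})"
    using c by (rule has_integral_Un) (rule negligible_subset[of "{0}"], auto)
  moreover have "{..0} \<union> {0..} = (UNIV :: real set)" by auto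
  ultimately have "c + c = 2 * b"
    using f by (metis has_integral_unique)
  then show ?thesis using c by simp
qed

text \<open>With x = \<open>g t\<close> one has 1 - x = exp (- t) / (2 cosh t) and dx = 2 x (1 - x)
  dt. The factor x (1 - x) raises both exponents of the Beta integrand by one, and x^a (1 - x)^b =
  exp ((a - b) t) / (2 cosh t)^(a + b). The powers of 2 collect to the constant.\<close>

lemma has_integral_exp_div_cosh:
  fixes a b :: real
  assumes a: "a > 0" and b: "b > 0"
  shows "((\<lambda>t. exp ((a - b) * t) / cosh t powr (a + b)) has_integral
           2 powr (a + b - 1) * Beta a b) UNIV"
proof -
  define g where "g t = exp t / (2 * cosh t)" for t :: real
  have cosh2: "2 * cosh t = exp t + exp (- t)" for t :: real
    by (simp add: cosh_field_def)
  have pos: "cosh t > 0" for t :: real by (rule cosh_real_pos)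
  have g1: "1 - g t = exp (- t) / (2 * cosh t)" for t
  proof -
    have "1 - g t = (2 * cosh t - exp t) / (2 * cosh t)"
      using pos[of t] by (simp add: g_def diff_divide_distrib)
    then show ?thesis using cosh2[of t] by simp
  qed
  have g01: "g t \<in> {0<..<1}" for t
  proof -
    have "0 < g t" "0 < 1 - g t"
      unfolding g1 using pos[of t] by (simp_all add: g_def)
    then show ?thesis by simp
  qed
  have der: "(g has_field_derivative 2 * g t * (1 - g t)) (at t)" for t
  proof -
    have frac: "2 * x * y / c\<^sup>2 = 2 * (x / c) * (y / c)" for x y c :: real
      by (simp add: power2_eq_square)
    have "(g has_field_derivative (exp t * (2 * cosh t) - exp t * (2 * sinh t)) / (2 * cosh t)^2) (at t)"
      unfolding g_def using pos[of t]
      by (auto intro!: derivative_eq_intros simp: power2_eq_square)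
    moreover have "exp t * (2 * cosh t) - exp t * (2 * sinh t) = 2 * exp t * exp (- t)"
      unfolding cosh_minus_sinh[symmetric] by (simp add: algebra_simps)
    moreover have "2 * g t * (1 - g t) = 2 * exp t * exp (- t) / (2 * cosh t)\<^sup>2"
      unfolding g1 unfolding g_def by (rule frac[symmetric])
    ultimately show ?thesis by (simp only:)
  qed
  \<comment> \<open>This quotient determines t, which gives injectivity; solved for t it provides
    the preimage of a point of the unit interval.\<close>
  have ratio: "g t / (1 - g t) = exp (2 * t)" for t
  proof -
    have "g t / (1 - g t) = exp t / exp (- t)"
      unfolding g1 unfolding g_def using pos[of t] by simp
    then show ?thesis by (simp add: exp_diff[symmetric])
  qed
  have inj: "inj g"
  proof (rule injI)
    fix s t assume "g s = g t"
    then have "exp (2 * s) = exp (2 * t)" unfolding ratio[symmetric] by (simp only:)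
    then show "s = t" by simp
  qed
  have img: "range g = {0<..<1}"
  proof (intro equalityI subsetI)
    fix x :: real assume x: "x \<in> {0<..<1}"
    define t where "t = ln (x / (1 - x)) / 2"
    have "g t / (1 - g t) = x / (1 - x)"
      unfolding ratio using x by (simp add: t_def)
    then have "g t * (1 - x) = x * (1 - g t)"
      using x g01[of t] by (subst (asm) frac_eq_eq) auto
    then have "g t = x" by (simp add: algebra_simps)
    then show "x \<in> range g" by blast
  qed (use g01 in auto)
  have powr: "\<bar>2 * g t * (1 - g t)\<bar> * (g t powr (a - 1) * (1 - g t) powr (b - 1))
      = 2 powr (1 - (a + b)) * (exp ((a - b) * t) / cosh t powr (a + b))" for t
  proof -
    have p: "g t > 0" "1 - g t > 0" using g01[of t] by auto
    have "\<bar>2 * g t * (1 - g t)\<bar> * (g t powr (a - 1) * (1 - g t) powr (b - 1))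
        = 2 * (g t powr a * (1 - g t) powr b)"
      using p by (simp add: powr_diff)
    also have "g t powr a = exp (a * t) / (2 powr a * cosh t powr a)"
      using pos[of t] by (simp add: g_def powr_divide powr_mult exp_powr_real mult.commute)
    also have "(1 - g t) powr b = exp (- b * t) / (2 powr b * cosh t powr b)"
      unfolding g1 using pos[of t] by (simp add: powr_divide powr_mult exp_powr_real mult.commute)
    finally show ?thesis
      by (simp add: powr_diff powr_add left_diff_distrib exp_diff exp_minus field_simps)
  qed
  have "((\<lambda>x. x powr (a - 1) * (1 - x) powr (b - 1)) has_integral Beta a b) {0<..<1}"
    using has_integral_Beta_real[OF a b] by (simp add: has_integral_Icc_iff_Ioo)
  then have "((\<lambda>t. \<bar>2 * g t * (1 - g t)\<bar> * (g t powr (a - 1) * (1 - g t) powr (b - 1)))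
      has_integral Beta a b) UNIV"
    using der inj img
    by (subst has_integral_substitution_nonneg
          [where g = g and f = "\<lambda>x. x powr (a - 1) * (1 - x) powr (b - 1)"]) auto
  then have "((\<lambda>t. 2 powr (a + b - 1) * (2 powr (1 - (a + b)) * (exp ((a - b) * t) / cosh t powr (a + b))))
      has_integral 2 powr (a + b - 1) * Beta a b) UNIV"
    unfolding powr by (rule has_integral_mult_right)
  moreover have "2 powr (a + b - 1) * (2 powr (1 - (a + b)) * y) = y" for y :: real
    by (simp add: mult.assoc[symmetric] powr_add[symmetric])
  ultimately show ?thesis by simp
qed

text \<open>cosh is the mean of two exponentials whose integrals arise from each other by exchanging
  a and b, and Beta is symmetric. Passing from the line to the half line halves the value.\<close>

lemma has_integral_cosh_div_cosh:
  fixes a b :: real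
  assumes a: "a > 0" and b: "b > 0"
  shows "((\<lambda>t. cosh ((a - b) * t) / cosh t powr (a + b)) has_integral
           2 powr (a + b - 2) * Beta a b) {0..}"
proof (rule has_integral_half_line_even)
  let ?I = "2 powr (a + b - 1) * Beta a b"
  have "((\<lambda>t. (exp ((a - b) * t) / cosh t powr (a + b) + exp ((b - a) * t) / cosh t powr (b + a)) / 2)
      has_integral (?I + 2 powr (b + a - 1) * Beta b a) / 2) UNIV"
    by (intro has_integral_divide has_integral_add has_integral_exp_div_cosh a b)
  moreover have "(?I + 2 powr (b + a - 1) * Beta b a) / 2 = 2 * (2 powr (a + b - 2) * Beta a b)"
    by (simp add: powr_diff Beta_commute add.commute)
  moreover have "(exp ((a - b) * t) / cosh t powr (a + b) + exp ((b - a) * t) / cosh t powr (b + a)) / 2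
      = cosh ((a - b) * t) / cosh t powr (a + b)" for t
    by (simp add: cosh_field_def add.commute[of b a] add_divide_distrib algebra_simps)
  ultimately show "((\<lambda>t. cosh ((a - b) * t) / cosh t powr (a + b)) has_integral
      2 * (2 powr (a + b - 2) * Beta a b)) UNIV"
    by simp
qed auto

lemma Gamma_integral_scaled:
  fixes s c :: real
  assumes s: "s > 0" and c: "c > 0"
  shows "((\<lambda>x. x powr (s - 1) * exp (- x * c)) has_integral Gamma s / c powr s) {0<..}"
proof -
  have img: "(\<lambda>x. c * x) ` {0<..} = {0<..}"
    using c by (auto simp: image_iff intro!: bexI[of _ "_ / c"])
  have "((\<lambda>t. t powr (s - 1) / exp t) has_integral Gamma s) {0<..}"
    using Gamma_integral_real[OF s]
    by (subst has_integral_spike_set_eq[of _ "{0..}"]) (auto intro: negligible_subset[of "{0}"])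
  then have "((\<lambda>x. \<bar>c\<bar> * ((c * x) powr (s - 1) / exp (c * x))) has_integral Gamma s) {0<..}"
    using c img
    by (subst has_integral_substitution_nonneg
          [where g = "\<lambda>x. c * x" and f = "\<lambda>t. t powr (s - 1) / exp t"])
      (auto intro!: derivative_eq_intros inj_onI)
  then have "((\<lambda>x. \<bar>c\<bar> * ((c * x) powr (s - 1) / exp (c * x)) / c powr s) has_integral Gamma s / c powr s) {0<..}"
    by (rule has_integral_divide)
  then show ?thesis
    using c by (elim has_integral_cong[THEN iffD1, rotated])
      (auto simp: powr_mult powr_diff exp_minus field_simps)
qed

lemma borel_measurable_cosh [measurable (raw)]:
  fixes f :: "'a \<Rightarrow> real"
  assumes "f \<in> borel_measurable M"
  shows "(\<lambda>x. cosh (f x)) \<in> borel_measurable M"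
  using assms unfolding cosh_field_def by measurable

lemma bessel_K_nonneg: "0 \<le> bessel_K \<nu> x"
  by (auto simp: bessel_K_def set_lebesgue_integral_def intro!: Bochner_Integration.integral_nonneg)

lemma borel_measurable_bessel_K [measurable]: "bessel_K \<nu> \<in> borel_measurable borel"
  unfolding bessel_K_def[abs_def] set_lebesgue_integral_def by measurable

text \<open>With \<mu> = a + b and \<nu> = a - b this is the classical formula in Gamma ((\<mu> +
  \<nu>) / 2) and Gamma ((\<mu> - \<nu>) / 2). In the parameters a and b the Beta function appears
  directly, and the factor Gamma (a + b) from the inner integral cancels its denominator.\<close>

lemma bessel_K_mellin:
  fixes a b :: real
  assumes a: "a > 0" and b: "b > 0"
  shows "((\<lambda>x. x powr (a + b - 1) * bessel_K (a - b) x) has_integral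
           2 powr (a + b - 2) * Gamma a * Gamma b) {0<..}"
proof -
  define f where "f t x = indicator {0<..} x * (x powr (a + b - 1) * exp (- x * cosh t))
    * (indicator {0..} t * cosh ((a - b) * t))" for t x :: real
  have f_meas [measurable]: "case_prod f \<in> borel_measurable (lborel \<Otimes>\<^sub>M lborel)"
    unfolding f_def by measurable
  have f_nonneg: "0 \<le> f t x" for t x by (simp add: f_def)
  have inner: "has_bochner_integral lborel (f t)
      (Gamma (a + b) * (indicator {0..} t * (cosh ((a - b) * t) / cosh t powr (a + b))))" for t
  proof -
    have "has_bochner_integral lborel (\<lambda>x. indicator {0<..} x * (x powr (a + b - 1) * exp (- x * cosh t)))
        (Gamma (a + b) / cosh t powr (a + b))"
      using a b Gamma_integral_scaled[of "a + b" "cosh t"]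
      by (subst has_bochner_integral_iff_has_integral_nonneg) auto
    from has_bochner_integral_mult_left[OF this, of "indicator {0..} t * cosh ((a - b) * t)"]
    have "has_bochner_integral lborel (f t)
        (Gamma (a + b) / cosh t powr (a + b) * (indicator {0..} t * cosh ((a - b) * t)))"
      by (simp only: f_def[abs_def])
    then show ?thesis by (simp add: mult.commute mult.left_commute)
  qed
  have outer: "has_bochner_integral lborel
      (\<lambda>t. Gamma (a + b) * (indicator {0..} t * (cosh ((a - b) * t) / cosh t powr (a + b))))
      (Gamma (a + b) * (2 powr (a + b - 2) * Beta a b))"
    using has_integral_cosh_div_cosh[OF a b]
    by (intro has_bochner_integral_mult_right)
      (subst has_bochner_integral_iff_has_integral_nonneg, auto)
  \<comment> \<open>Since \<open>f\<close> is nonnegative, integrability on the product follows from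
    the iterated integral with x inside. The opposite order, with t inside, produces
    \<open>bessel_K\<close>.\<close>
  have int: "integrable (lborel \<Otimes>\<^sub>M lborel) (case_prod f)"
  proof (rule lborel_pair.Fubini_integrable[OF f_meas])
    show "integrable lborel (\<lambda>t. LINT x|lborel. norm (case_prod f (t, x)))"
      using outer inner f_nonneg by (simp add: has_bochner_integral_iff)
    show "AE t in lborel. integrable lborel (\<lambda>x. case_prod f (t, x))"
      using inner by (simp add: has_bochner_integral_iff)
  qed
  have K: "(LINT t|lborel. f t x) = indicator {0<..} x * (x powr (a + b - 1) * bessel_K (a - b) x)" for x
    by (simp add: f_def bessel_K_def set_lebesgue_integral_def mult_ac flip: integral_mult_right_zero)
  have "has_bochner_integral lborel (\<lambda>x. LINT t|lborel. f t x) (LINT t|lborel. LINT x|lborel. f t x)"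
    using lborel_pair.integrable_snd[OF int] lborel_pair.Fubini_integral[OF int]
    by (simp add: has_bochner_integral_iff)
  also have "(LINT t|lborel. LINT x|lborel. f t x) = Gamma (a + b) * (2 powr (a + b - 2) * Beta a b)"
    using outer inner by (simp add: has_bochner_integral_iff)
  also have "\<dots> = 2 powr (a + b - 2) * Gamma a * Gamma b"
    using Gamma_real_pos[OF add_pos_pos[OF a b]] by (simp add: Beta_def)
  finally show ?thesis
    unfolding K by (subst (asm) has_bochner_integral_iff_has_integral_nonneg) (auto simp: bessel_K_nonneg)
qed

text \<open>The substitution x = u^n / n matches the argument of the Bessel function in the weights,
  u being the squared modulus. Here dx = u^(n - 1) du, and multiplication by n^(a + b - 1) removes
  the denominator of x^(a + b - 1).\<close>

lemma bessel_K_power_mellin: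
  fixes a b :: real and n :: nat
  assumes a: "a > 0" and b: "b > 0" and n: "n \<ge> 1"
  shows "has_bochner_integral lborel
     (\<lambda>u. indicator {0<..} u * (u powr (real n * (a + b) - 1) * bessel_K (a - b) (u ^ n / real n)))
     ((2 * real n) powr (a + b - 1) * Gamma a * Gamma b / 2)"
proof (subst has_bochner_integral_iff_has_integral_nonneg)
  let ?f = "\<lambda>x. x powr (a + b - 1) * bessel_K (a - b) x"
  have img: "(\<lambda>u. u ^ n / real n) ` {0<..} = {0<..}"
  proof safe
    fix x :: real assume x: "x > 0"
    then have "x = (root n (real n * x)) ^ n / real n" "root n (real n * x) > 0"
      using n by auto
    then show "x \<in> (\<lambda>u. u ^ n / real n) ` {0<..}" by blast
  qed (use n in auto)
  have inj: "inj_on (\<lambda>u. u ^ n / real n) {0<..}"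
    using n by (auto intro!: inj_onI simp: power_eq_iff_eq_base)
  have "((\<lambda>u. \<bar>u ^ (n - 1)\<bar> * ?f (u ^ n / real n)) has_integral
      2 powr (a + b - 2) * Gamma a * Gamma b) {0<..}"
    using n img inj bessel_K_mellin[OF a b]
    by (subst has_integral_substitution_nonneg[where g = "\<lambda>u. u ^ n / real n" and f = ?f])
      (auto intro!: derivative_eq_intros mult_nonneg_nonneg bessel_K_nonneg)
  then have "((\<lambda>u. real n powr (a + b - 1) * (\<bar>u ^ (n - 1)\<bar> * ?f (u ^ n / real n))) has_integral
      real n powr (a + b - 1) * (2 powr (a + b - 2) * Gamma a * Gamma b)) {0<..}"
    by (rule has_integral_mult_right)
  moreover have "real n powr (a + b - 1) * (2 powr (a + b - 2) * Gamma a * Gamma b)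
      = (2 * real n) powr (a + b - 1) * Gamma a * Gamma b / 2"
    by (simp add: powr_mult powr_diff) (simp only: mult.commute mult.left_commute)
  moreover have "real n powr (a + b - 1) * (\<bar>u ^ (n - 1)\<bar> * ?f (u ^ n / real n))
      = u powr (real n * (a + b) - 1) * bessel_K (a - b) (u ^ n / real n)" if u: "u > 0" for u
  proof -
    have "u ^ n = u powr real n" "u ^ (n - 1) = u powr (real n - 1)"
      using u n by (simp_all add: powr_realpow[symmetric] of_nat_diff)
    then have "real n powr (a + b - 1) * (u ^ (n - 1) * (u ^ n / real n) powr (a + b - 1))
        = u powr (real n * (a + b) - 1)"
      using u n by (simp add: powr_divide powr_powr powr_add[symmetric] algebra_simps)
    then show ?thesis using u by (simp add: mult_ac)
  qed
  ultimately show "((\<lambda>u. u powr (real n * (a + b) - 1) * bessel_K (a - b) (u ^ n / real n))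
      has_integral (2 * real n) powr (a + b - 1) * Gamma a * Gamma b / 2) {0<..}"
    by (auto elim!: has_integral_cong[THEN iffD1, rotated])
qed (auto simp: bessel_K_nonneg)

section \<open>Spaces of square summable series\<close>

lemma mult_le_sum_squares: "x * y \<le> x\<^sup>2 + y\<^sup>2" for x y :: real
  using sum_squares_bound[of x y] zero_le_power2[of x] zero_le_power2[of y] by linarith

lemma summable_mult_l2:
  fixes c d :: "nat \<Rightarrow> complex"
  assumes c: "summable (\<lambda>l. (cmod (c l))\<^sup>2)" and d: "summable (\<lambda>l. (cmod (d l))\<^sup>2)"
  shows "summable (\<lambda>l. cmod (c l * d l))"
  by (rule summable_comparison_test'[OF summable_add[OF c d]])
    (simp add: norm_mult mult_le_sum_squares)

lemma summable_add_l2: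
  fixes c d :: "nat \<Rightarrow> complex"
  assumes c: "summable (\<lambda>l. (cmod (c l))\<^sup>2)" and d: "summable (\<lambda>l. (cmod (d l))\<^sup>2)"
  shows "summable (\<lambda>l. (cmod (c l + d l))\<^sup>2)"
proof (rule summable_comparison_test'[OF summable_mult[OF summable_add[OF c d], of 2]])
  show "norm ((cmod (c l + d l))\<^sup>2) \<le> 2 * ((cmod (c l))\<^sup>2 + (cmod (d l))\<^sup>2)" for l
    using power_mono[OF norm_triangle_ineq[of "c l" "d l"], of 2]
      sum_squares_bound[of "cmod (c l)" "cmod (d l)"]
    by (simp add: power2_sum)
qed

lemma summable_scale_l2:
  fixes d :: "nat \<Rightarrow> complex"
  assumes d: "summable (\<lambda>l. (cmod (d l))\<^sup>2)"
  shows "summable (\<lambda>l. (cmod (a * d l))\<^sup>2)"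
  using summable_mult[OF d, of "(cmod a)\<^sup>2"] by (simp add: norm_mult power_mult_distrib)

lemma norm_suminf_mult_le_l2:
  fixes c d :: "nat \<Rightarrow> complex"
  assumes c: "summable (\<lambda>l. (cmod (c l))\<^sup>2)" and d: "summable (\<lambda>l. (cmod (d l))\<^sup>2)"
  shows "cmod (\<Sum>l. c l * d l) \<le> sqrt (\<Sum>l. (cmod (c l))\<^sup>2) * sqrt (\<Sum>l. (cmod (d l))\<^sup>2)"
proof -
  have "cmod (\<Sum>l. c l * d l) \<le> (\<Sum>l. cmod (c l * d l))"
    by (rule summable_norm[OF summable_mult_l2[OF c d]])
  also have "\<dots> \<le> sqrt (\<Sum>l. (cmod (c l))\<^sup>2) * sqrt (\<Sum>l. (cmod (d l))\<^sup>2)"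
  proof (rule suminf_le_const[OF summable_mult_l2[OF c d]])
    fix n
    have "(\<Sum>l<n. cmod (c l * d l)) \<le> L2_set (\<lambda>l. cmod (c l)) {..<n} * L2_set (\<lambda>l. cmod (d l)) {..<n}"
      using L2_set_mult_ineq[of "\<lambda>l. cmod (c l)" "\<lambda>l. cmod (d l)" "{..<n}"]
      by (simp add: norm_mult)
    also have "\<dots> \<le> sqrt (\<Sum>l. (cmod (c l))\<^sup>2) * sqrt (\<Sum>l. (cmod (d l))\<^sup>2)"
      unfolding L2_set_def
      by (intro mult_mono real_sqrt_le_mono sum_le_suminf c d)
        (auto intro!: sum_nonneg suminf_nonneg c)
    finally show "(\<Sum>l<n. cmod (c l * d l)) \<le> sqrt (\<Sum>l. (cmod (c l))\<^sup>2) * sqrt (\<Sum>l. (cmod (d l))\<^sup>2)" .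
  qed
  finally show ?thesis .
qed

text \<open>The assumption \<open>parseval\<close> says that summation of series is an isometry from
  the square summable sequences, so the Hilbert space axioms are pulled back from there. It speaks
  about functions, hence the value of \<open>ip\<close> is the same for every choice of
  coefficients. Assumption \<open>e\<close> makes all series converge and, by Cauchy-Schwarz, bounds
  evaluation.\<close>

lemma rkhs_l2_series_space:
  fixes e :: "nat \<Rightarrow> complex \<Rightarrow> complex"
  assumes e: "\<And>z. summable (\<lambda>l. (cmod (e l z))\<^sup>2)"
    and parseval: "\<And>c d f g.
        summable (\<lambda>l. (cmod (c l))\<^sup>2) \<Longrightarrow> summable (\<lambda>l. (cmod (d l))\<^sup>2) \<Longrightarrow>
        (\<forall>z. (\<lambda>l. c l * e l z) sums f z) \<Longrightarrow> (\<forall>z. (\<lambda>l. d l * e l z) sums g z) \<Longrightarrow>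
        (\<lambda>l. c l * cnj (d l)) sums ip f g"
  shows "rkhs (l2_series_space e) ip" (is ?rkhs)
    and "summable (\<lambda>l. e l z * cnj (e l w))" (is ?sum)
    and "reproducing_kernel (l2_series_space e) ip (\<lambda>w z. \<Sum>l. e l z * cnj (e l w))" (is ?rep)
proof -
  let ?H = "l2_series_space e"
  define l2 :: "(nat \<Rightarrow> complex) \<Rightarrow> bool" where "l2 c \<longleftrightarrow> summable (\<lambda>l. (cmod (c l))\<^sup>2)" for c
  define F where "F c z = (\<Sum>l. c l * e l z)" for c z
  define N2 :: "(nat \<Rightarrow> complex) \<Rightarrow> real" where "N2 c = (\<Sum>l. (cmod (c l))\<^sup>2)" for c
  have summ: "summable (\<lambda>l. c l * e l z)" if "l2 c" for c z
    using summable_norm_cancel[OF summable_mult_l2[OF _ e]] that by (simp add: l2_def)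
  have F_sums: "(\<lambda>l. c l * e l z) sums F c z" if "l2 c" for c z
    using summable_sums[OF summ[OF that]] by (simp add: F_def)
  have F_in: "F c \<in> ?H" if "l2 c" for c
    using F_sums[OF that] that by (auto simp: l2_series_space_def l2_def)
  have H_obtain: "\<exists>c. l2 c \<and> f = F c" if "f \<in> ?H" for f
    using that by (auto simp: l2_series_space_def l2_def F_def fun_eq_iff sums_iff)
  have ip: "(\<lambda>l. c l * cnj (d l)) sums ip (F c) (F d)" if "l2 c" "l2 d" for c d
    using that F_sums by (intro parseval) (auto simp: l2_def)
  have l2_add: "l2 (\<lambda>l. c l + d l)" if "l2 c" "l2 d" for c d
    using that by (simp add: l2_def summable_add_l2)
  have l2_scale: "l2 (\<lambda>l. a * c l)" if "l2 c" for a c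
    using that by (simp add: l2_def summable_scale_l2)
  have l2_diff: "l2 (\<lambda>l. c l - d l)" if "l2 c" "l2 d" for c d
    using l2_add[OF that(1) l2_scale[OF that(2), of "-1"]] by simp
  have F_add: "F (\<lambda>l. c l + d l) = (\<lambda>z. F c z + F d z)" if "l2 c" "l2 d" for c d
    by (rule ext) (simp add: F_def distrib_right suminf_add[symmetric] summ that)
  have F_scale: "F (\<lambda>l. a * c l) = (\<lambda>z. a * F c z)" if "l2 c" for a c
    by (rule ext) (simp add: F_def mult.assoc suminf_mult summ that)
  have F_diff: "F (\<lambda>l. c l - d l) = (\<lambda>z. F c z - F d z)" if "l2 c" "l2 d" for c d
    using F_add[OF that(1) l2_scale[OF that(2), of "-1"]] F_scale[OF that(2), of "-1"] by simp
  have ip_self: "ip (F c) (F c) = complex_of_real (N2 c)" if "l2 c" for c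
  proof -
    have "(\<lambda>l. complex_of_real ((cmod (c l))\<^sup>2)) sums complex_of_real (N2 c)"
      using that by (intro sums_of_real) (simp add: N2_def l2_def summable_sums)
    with ip[OF that that] show ?thesis
      unfolding complex_norm_square by (rule sums_unique2)
  qed
  have N2_nonneg: "0 \<le> N2 c" if "l2 c" for c
    using that by (auto simp: N2_def l2_def intro: suminf_nonneg)
  have sub: "fun_subspace ?H"
    unfolding fun_subspace_def
  proof (intro conjI ballI allI)
    have z: "l2 (\<lambda>l. 0)" by (simp add: l2_def)
    show "(\<lambda>x. 0) \<in> ?H" using F_in[OF z] by (simp add: F_def[abs_def])
    show "(\<lambda>x. f x + g x) \<in> ?H" if fg: "f \<in> ?H" "g \<in> ?H" for f g
      using H_obtain[OF fg(1)] H_obtain[OF fg(2)] F_in[OF l2_add] F_add by auto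
    show "(\<lambda>x. a * f x) \<in> ?H" if f: "f \<in> ?H" for a f
      using H_obtain[OF f] F_in[OF l2_scale] F_scale by auto
  qed
  have inner: "inner_product_on ?H ip"
    unfolding inner_product_on_def
  proof (intro conjI ballI allI impI)
    fix f g h assume "f \<in> ?H" "g \<in> ?H" "h \<in> ?H"
    then obtain c d k where c: "l2 c" "f = F c" and d: "l2 d" "g = F d" and k: "l2 k" "h = F k"
      using H_obtain by metis
    show "ip (\<lambda>x. f x + g x) h = ip f h + ip g h"
      using sums_add[OF ip[OF c(1) k(1)] ip[OF d(1) k(1)]] ip[OF l2_add[OF c(1) d(1)] k(1)]
      unfolding F_add[OF c(1) d(1)] c(2) d(2) k(2) by (simp add: distrib_right sums_unique2)
  next
    fix a f h assume "f \<in> ?H" "h \<in> ?H"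
    then obtain c k where c: "l2 c" "f = F c" and k: "l2 k" "h = F k"
      using H_obtain by metis
    show "ip (\<lambda>x. a * f x) h = a * ip f h"
      using sums_mult[OF ip[OF c(1) k(1)], of a] ip[OF l2_scale[OF c(1)] k(1), of a]
      unfolding F_scale[OF c(1)] c(2) k(2) by (simp add: mult.assoc sums_unique2)
  next
    fix f g assume "f \<in> ?H" "g \<in> ?H"
    then obtain c d where c: "l2 c" "f = F c" and d: "l2 d" "g = F d"
      using H_obtain by metis
    have "(\<lambda>l. cnj (c l * cnj (d l))) sums cnj (ip f g)"
      using ip[OF c(1) d(1)] unfolding c(2) d(2) by (simp only: sums_cnj)
    then show "ip g f = cnj (ip f g)"
      using ip[OF d(1) c(1)] unfolding c(2) d(2) by (simp add: mult.commute sums_unique2)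
  next
    fix f assume "f \<in> ?H"
    then obtain c where c: "l2 c" "f = F c" using H_obtain by metis
    show "0 \<le> Re (ip f f)" using ip_self[OF c(1)] N2_nonneg[OF c(1)] c(2) by simp
    assume "ip f f = 0"
    then have "N2 c = 0" using ip_self[OF c(1)] c(2) by simp
    then have "c l = 0" for l
      using c(1) suminf_eq_zero_iff[of "\<lambda>l. (cmod (c l))\<^sup>2"] by (simp add: N2_def l2_def)
    then show "f = (\<lambda>x. 0)" by (simp add: c(2) F_def[abs_def])
  qed
  interpret Metric_space ?H "ip_dist ?H ip"
    by (rule Metric_space_ip_dist[OF sub inner])
  have dist: "ip_dist ?H ip (F c) (F d) = sqrt (N2 (\<lambda>l. c l - d l))" if "l2 c" "l2 d" for c d
    using ip_self[OF l2_diff[OF that]] F_in[OF that(1)] F_in[OF that(2)] F_diff[OF that]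
    by (simp add: ip_dist_def)
  \<comment> \<open>A coordinate is dominated by the norm, so a Cauchy sequence in the space has
    Cauchy coordinates; their limits are the candidate for the limit sequence.\<close>
  have coord_le: "cmod (c l - d l) \<le> ip_dist ?H ip (F c) (F d)" if "l2 c" "l2 d" for c d l
  proof -
    have "(\<Sum>i\<in>{l}. (cmod (c i - d i))\<^sup>2) \<le> N2 (\<lambda>l. c l - d l)"
      unfolding N2_def using l2_diff[OF that] by (intro sum_le_suminf) (auto simp: l2_def)
    then show ?thesis
      unfolding dist[OF that] by (intro real_le_rsqrt) simp
  qed
  have complete: mcomplete
    unfolding mcomplete_def
  proof (intro allI impI)
    fix \<sigma> assume \<sigma>: "MCauchy \<sigma>"
    then have "\<forall>j. \<exists>c. l2 c \<and> \<sigma> j = F c"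
      using H_obtain by (auto simp: MCauchy_def image_subset_iff)
    then obtain c where c: "\<And>j. l2 (c j)" "\<And>j. \<sigma> j = F (c j)" by metis
    have ev: "\<exists>N. \<forall>j\<ge>N. \<forall>k\<ge>N. ip_dist ?H ip (F (c j)) (F (c k)) < \<epsilon>" if "\<epsilon> > 0" for \<epsilon>
      using \<sigma> that unfolding MCauchy_def c(2) by metis
    have "Cauchy (\<lambda>j. c j l)" for l
    proof (rule CauchyI)
      fix \<epsilon> :: real assume "\<epsilon> > 0"
      then show "\<exists>N. \<forall>j\<ge>N. \<forall>k\<ge>N. cmod (c j l - c k l) < \<epsilon>"
        using ev coord_le[OF c(1) c(1), of _ l] by (meson le_less_trans)
    qed
    then have "\<forall>l. \<exists>x. (\<lambda>j. c j l) \<longlonglongrightarrow> x"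
      by (simp add: Cauchy_convergent_iff convergent_def)
    then obtain x where x: "\<And>l. (\<lambda>j. c j l) \<longlonglongrightarrow> x l" by metis
    \<comment> \<open>The coordinates converge without uniformity in l, so the limit in k is taken
      in finite partial sums; the resulting bound does not depend on the number m of terms and
      survives as m grows.\<close>
    have key: "\<exists>N. \<forall>j\<ge>N. l2 (\<lambda>l. c j l - x l) \<and> N2 (\<lambda>l. c j l - x l) \<le> \<epsilon>\<^sup>2" if \<epsilon>: "\<epsilon> > 0" for \<epsilon>
    proof -
      obtain N where N: "\<And>j k. j \<ge> N \<Longrightarrow> k \<ge> N \<Longrightarrow> ip_dist ?H ip (F (c j)) (F (c k)) < \<epsilon>"
        using ev[OF \<epsilon>] by blast
      have "l2 (\<lambda>l. c j l - x l) \<and> N2 (\<lambda>l. c j l - x l) \<le> \<epsilon>\<^sup>2" if j: "j \<ge> N" for j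
      proof -
        have part: "(\<Sum>l<m. (cmod (c j l - x l))\<^sup>2) \<le> \<epsilon>\<^sup>2" for m
        proof (rule LIMSEQ_le_const2)
          show "(\<lambda>k. \<Sum>l<m. (cmod (c j l - c k l))\<^sup>2) \<longlonglongrightarrow> (\<Sum>l<m. (cmod (c j l - x l))\<^sup>2)"
            by (intro tendsto_intros x)
          show "\<exists>N. \<forall>k\<ge>N. (\<Sum>l<m. (cmod (c j l - c k l))\<^sup>2) \<le> \<epsilon>\<^sup>2"
          proof (intro exI allI impI)
            fix k assume k: "k \<ge> N"
            have "(\<Sum>l<m. (cmod (c j l - c k l))\<^sup>2) \<le> N2 (\<lambda>l. c j l - c k l)"
              unfolding N2_def using l2_diff[OF c(1) c(1)] by (intro sum_le_suminf) (auto simp: l2_def)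
            also have "\<dots> = (sqrt (N2 (\<lambda>l. c j l - c k l)))\<^sup>2"
              using N2_nonneg[OF l2_diff[OF c(1) c(1)]] by simp
            also have "\<dots> \<le> \<epsilon>\<^sup>2"
              using N[OF j k] N2_nonneg[OF l2_diff[OF c(1) c(1)]] unfolding dist[OF c(1) c(1)]
              by (intro power_mono) auto
            finally show "(\<Sum>l<m. (cmod (c j l - c k l))\<^sup>2) \<le> \<epsilon>\<^sup>2" .
          qed
        qed
        have "l2 (\<lambda>l. c j l - x l)"
          unfolding l2_def by (rule summableI_nonneg_bounded[OF _ part]) simp
        then show ?thesis
          unfolding N2_def l2_def by (auto intro!: suminf_le_const part)
      qed
      then show ?thesis by blast
    qed
    obtain N1 where "l2 (\<lambda>l. c N1 l - x l)" using key[of 1] by auto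
    from l2_diff[OF c(1)[of N1] this] have x2: "l2 x" by simp
    have "limitin mtopology \<sigma> (F x) sequentially"
      unfolding limit_metric_sequentially
    proof (intro conjI allI impI F_in x2)
      fix \<epsilon> :: real assume \<epsilon>: "\<epsilon> > 0"
      \<comment> \<open>Halving restores the strict inequality, which was weakened by passing to the
        limit in \<open>key\<close>.\<close>
      then obtain N where N: "\<And>j. j \<ge> N \<Longrightarrow> N2 (\<lambda>l. c j l - x l) \<le> (\<epsilon> / 2)\<^sup>2"
        using key[of "\<epsilon> / 2"] by auto
      have "ip_dist ?H ip (\<sigma> j) (F x) < \<epsilon>" if "j \<ge> N" for j
      proof -
        have "sqrt (N2 (\<lambda>l. c j l - x l)) \<le> \<epsilon> / 2"
          using real_sqrt_le_mono[OF N[OF that]] \<epsilon> by simp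
        then show ?thesis using \<epsilon> by (simp add: c(2) dist[OF c(1) x2])
      qed
      then show "\<exists>N. \<forall>j\<ge>N. \<sigma> j \<in> ?H \<and> ip_dist ?H ip (\<sigma> j) (F x) < \<epsilon>"
        using c F_in by auto
    qed
    then show "\<exists>f. limitin mtopology \<sigma> f sequentially" by blast
  qed
  have cont: "continuous_map mtopology euclidean (\<lambda>f. f z)" for z
  proof -
    \<comment> \<open>The summand 1 keeps \<open>B\<close> positive when every \<open>e l z\<close>
      vanishes, so that \<epsilon> / B can serve as \<delta>.\<close>
    define B where "B = sqrt (\<Sum>l. (cmod (e l z))\<^sup>2) + 1"
    have B: "B > 0" using suminf_nonneg[OF e[of z]] by (simp add: B_def add_nonneg_pos)
    have le: "dist (f z) (g z) \<le> ip_dist ?H ip f g * B" if fg: "f \<in> ?H" "g \<in> ?H" for f g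
    proof -
      obtain c d where c: "l2 c" "f = F c" and d: "l2 d" "g = F d"
        using H_obtain fg by metis
      have "dist (f z) (g z) = cmod (F (\<lambda>l. c l - d l) z)"
        by (simp add: F_diff[OF c(1) d(1)] c(2) d(2) dist_norm)
      also have "\<dots> \<le> sqrt (N2 (\<lambda>l. c l - d l)) * sqrt (\<Sum>l. (cmod (e l z))\<^sup>2)"
        unfolding F_def N2_def using l2_diff[OF c(1) d(1)]
        by (intro norm_suminf_mult_le_l2 e) (simp add: l2_def)
      also have "\<dots> \<le> sqrt (N2 (\<lambda>l. c l - d l)) * B"
        using N2_nonneg[OF l2_diff[OF c(1) d(1)]] by (intro mult_left_mono) (auto simp: B_def)
      finally show ?thesis by (simp add: c(2) d(2) dist[OF c(1) d(1)])
    qed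
    have "continuous_map mtopology Met_TC.mtopology (\<lambda>f. f z)"
    proof (subst metric_continuous_map[OF Met_TC.Metric_space_axioms], intro conjI ballI allI impI)
      fix f and \<epsilon> :: real assume f: "f \<in> ?H" and \<epsilon>: "\<epsilon> > 0"
      have "dist (f z) (g z) < \<epsilon>" if g: "g \<in> ?H" "ip_dist ?H ip f g < \<epsilon> / B" for g
        using le[OF f g(1)] g(2) B by (simp add: pos_less_divide_eq)
      then show "\<exists>\<delta>>0. \<forall>g. g \<in> ?H \<and> ip_dist ?H ip f g < \<delta> \<longrightarrow> dist (f z) (g z) < \<epsilon>"
        using \<epsilon> B by (intro exI[of _ "\<epsilon> / B"]) auto
    qed auto
    then show ?thesis by simp
  qed
  show ?rkhs
    using sub inner complete cont by (simp add: rkhs_def function_hilbert_space_def)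
  \<comment> \<open>The second coefficient is conjugated in \<open>parseval\<close>, so these
    conjugated values turn the inner product with \<open>F c\<close> into the series for
    \<open>F c w\<close>.\<close>
  have k2: "l2 (\<lambda>l. cnj (e l w))" for w using e by (simp add: l2_def)
  have kernel: "(\<lambda>z. \<Sum>l. e l z * cnj (e l w)) = F (\<lambda>l. cnj (e l w))" for w
    by (simp add: F_def[abs_def] mult.commute)
  show ?sum using summ[OF k2] by (simp add: mult.commute)
  show ?rep
    unfolding reproducing_kernel_def kernel
  proof (intro conjI allI ballI F_in k2)
    fix w f assume "f \<in> ?H"
    then obtain c where c: "l2 c" "f = F c" using H_obtain by metis
    show "ip f (F (\<lambda>l. cnj (e l w))) = f w"
      using ip[OF c(1) k2[of w]] F_sums[OF c(1), of w] unfolding c(2) by (simp add: sums_unique2)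
  qed
qed

section \<open>Series of orthonormal functions\<close>

lemma borel_measurable_cnj [measurable (raw)]:
  fixes f :: "'a \<Rightarrow> complex"
  assumes "f \<in> borel_measurable M"
  shows "(\<lambda>x. cnj (f x)) \<in> borel_measurable M"
  by (rule measurable_compose[OF assms borel_measurable_continuous_onI]) (rule continuous_on_cnj[OF continuous_on_id])

lemma integrable_mult_cnj:
  fixes f g :: "'a \<Rightarrow> complex"
  assumes [measurable]: "f \<in> borel_measurable M" "g \<in> borel_measurable M"
    and f: "integrable M (\<lambda>x. (cmod (f x))\<^sup>2)" and g: "integrable M (\<lambda>x. (cmod (g x))\<^sup>2)"
  shows "integrable M (\<lambda>x. f x * cnj (g x))"
  by (rule Bochner_Integration.integrable_bound[OF Bochner_Integration.integrable_add[OF f g]])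
    (auto simp: norm_mult mult_le_sum_squares)

lemma norm_integral_mult_cnj_le:
  fixes f g :: "'a \<Rightarrow> complex"
  assumes [measurable]: "f \<in> borel_measurable M" "g \<in> borel_measurable M"
    and f: "integrable M (\<lambda>x. (cmod (f x))\<^sup>2)" and g: "integrable M (\<lambda>x. (cmod (g x))\<^sup>2)"
  shows "cmod (LINT x|M. f x * cnj (g x))
    \<le> sqrt (LINT x|M. (cmod (f x))\<^sup>2) * sqrt (LINT x|M. (cmod (g x))\<^sup>2)"
proof -
  have int: "integrable M (\<lambda>x. cmod (f x) * cmod (g x))"
    using integrable_norm[OF integrable_mult_cnj[OF assms]] by (simp add: norm_mult)
  \<comment> \<open>Cauchy-Schwarz is applied to extended nonnegative integrals; square
    integrability makes them finite, so the estimate returns to the reals.\<close>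
  have "ennreal ((LINT x|M. cmod (f x) * cmod (g x))\<^sup>2) = (\<integral>\<^sup>+x. ennreal (cmod (f x)) * ennreal (cmod (g x)) \<partial>M)\<^sup>2"
    using nn_integral_eq_integral[OF int]
    by (simp add: ennreal_mult[symmetric] ennreal_power[symmetric] Bochner_Integration.integral_nonneg)
  also have "\<dots> \<le> (\<integral>\<^sup>+x. (ennreal (cmod (f x)))\<^sup>2 \<partial>M) * (\<integral>\<^sup>+x. (ennreal (cmod (g x)))\<^sup>2 \<partial>M)"
    by (rule Cauchy_Schwarz_nn_integral) auto
  also have "\<dots> = ennreal ((LINT x|M. (cmod (f x))\<^sup>2) * (LINT x|M. (cmod (g x))\<^sup>2))"
    using nn_integral_eq_integral[OF f] nn_integral_eq_integral[OF g]
    by (simp add: ennreal_power ennreal_mult Bochner_Integration.integral_nonneg)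
  finally have "(LINT x|M. cmod (f x) * cmod (g x))\<^sup>2 \<le> (LINT x|M. (cmod (f x))\<^sup>2) * (LINT x|M. (cmod (g x))\<^sup>2)"
    by (subst (asm) ennreal_le_iff) (auto intro!: mult_nonneg_nonneg Bochner_Integration.integral_nonneg)
  then have "(LINT x|M. cmod (f x) * cmod (g x))
      \<le> sqrt (LINT x|M. (cmod (f x))\<^sup>2) * sqrt (LINT x|M. (cmod (g x))\<^sup>2)"
    unfolding real_sqrt_mult[symmetric] by (rule real_le_rsqrt)
  moreover have "cmod (LINT x|M. f x * cnj (g x)) \<le> (LINT x|M. cmod (f x) * cmod (g x))"
    using integral_norm_bound[of M "\<lambda>x. f x * cnj (g x)"] by (simp add: norm_mult)
  ultimately show ?thesis by linarith
qed

text \<open>The weight enters later through \<open>M\<close>, as a density with respect to Lebesgue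
  measure.\<close>

locale orthonormal_functions =
  fixes M :: "'a measure" and e :: "nat \<Rightarrow> 'a \<Rightarrow> complex"
  assumes meas [measurable]: "\<And>l. e l \<in> borel_measurable M"
    and square_integrable: "\<And>l. integrable M (\<lambda>x. (cmod (e l x))\<^sup>2)"
    and orthonormal: "\<And>k l. (LINT x|M. e k x * cnj (e l x)) = (if k = l then 1 else 0)"
begin

lemma integral_sum_mult_cnj_sum:
  assumes A: "finite A"
  shows "integrable M (\<lambda>x. (\<Sum>l\<in>A. c l * e l x) * cnj (\<Sum>l\<in>A. d l * e l x))" (is ?int)
    and "(LINT x|M. (\<Sum>l\<in>A. c l * e l x) * cnj (\<Sum>l\<in>A. d l * e l x)) = (\<Sum>l\<in>A. c l * cnj (d l))"
      (is ?eq)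
proof -
  have int: "integrable M (\<lambda>x. e k x * cnj (e l x))" for k l
    by (rule integrable_mult_cnj) (auto intro: square_integrable)
  have expand: "(\<lambda>x. (\<Sum>l\<in>A. c l * e l x) * cnj (\<Sum>l\<in>A. d l * e l x))
      = (\<lambda>x. \<Sum>k\<in>A. \<Sum>l\<in>A. (c k * cnj (d l)) * (e k x * cnj (e l x)))"
    by (simp add: sum_product mult_ac)
  have "has_bochner_integral M (\<lambda>x. \<Sum>k\<in>A. \<Sum>l\<in>A. (c k * cnj (d l)) * (e k x * cnj (e l x)))
      (\<Sum>k\<in>A. \<Sum>l\<in>A. (c k * cnj (d l)) * (if k = l then 1 else 0))"
    using int by (intro has_bochner_integral_sum has_bochner_integral_mult_right)
      (simp add: has_bochner_integral_iff orthonormal)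
  also have "(\<Sum>k\<in>A. \<Sum>l\<in>A. (c k * cnj (d l)) * (if k = l then 1 else 0)) = (\<Sum>l\<in>A. c l * cnj (d l))"
    using A by (simp add: if_distrib cong: if_cong)
  finally show ?int ?eq unfolding expand by (simp_all add: has_bochner_integral_iff)
qed

lemma integral_norm_sum_square:
  assumes A: "finite A"
  shows "integrable M (\<lambda>x. (cmod (\<Sum>l\<in>A. c l * e l x))\<^sup>2)" (is ?int)
    and "(LINT x|M. (cmod (\<Sum>l\<in>A. c l * e l x))\<^sup>2) = (\<Sum>l\<in>A. (cmod (c l))\<^sup>2)" (is ?eq)
proof -
  have *: "integrable M (\<lambda>x. complex_of_real ((cmod (\<Sum>l\<in>A. c l * e l x))\<^sup>2))"
    unfolding complex_norm_square by (rule integral_sum_mult_cnj_sum[OF A])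
  show int: ?int by (rule complex_of_real_integrable_eq[THEN iffD1, OF *])
  have "complex_of_real (LINT x|M. (cmod (\<Sum>l\<in>A. c l * e l x))\<^sup>2)
      = (LINT x|M. complex_of_real ((cmod (\<Sum>l\<in>A. c l * e l x))\<^sup>2))"
    by (rule integral_of_real[OF int, symmetric])
  also have "\<dots> = (\<Sum>l\<in>A. c l * cnj (c l))"
    unfolding complex_norm_square by (rule integral_sum_mult_cnj_sum[OF A])
  also have "\<dots> = complex_of_real (\<Sum>l\<in>A. (cmod (c l))\<^sup>2)"
    by (simp only: of_real_sum complex_norm_square)
  finally show ?eq by (simp only: of_real_eq_iff)
qed

text \<open>Fatou's lemma bounds the remainder, so only pointwise convergence of the series is needed.\<close>

lemma integral_norm_remainder_square_le:
  fixes c :: "nat \<Rightarrow> complex"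
  assumes c: "summable (\<lambda>l. (cmod (c l))\<^sup>2)" and f: "\<And>x. (\<lambda>l. c l * e l x) sums f x"
  defines "R \<equiv> \<lambda>N x. f x - (\<Sum>l<N. c l * e l x)"
  shows "R N \<in> borel_measurable M" (is ?meas)
    and "integrable M (\<lambda>x. (cmod (R N x))\<^sup>2)" (is ?int)
    and "(LINT x|M. (cmod (R N x))\<^sup>2) \<le> (\<Sum>l. (cmod (c (l + N)))\<^sup>2)" (is ?le)
proof -
  have lim: "(\<lambda>m. \<Sum>l<m. c l * e l x) \<longlonglongrightarrow> f x" for x
    using f[of x] by (simp add: sums_def)
  have fm [measurable]: "f \<in> borel_measurable M"
    by (rule borel_measurable_LIMSEQ_metric[OF _ lim]) measurable
  show Rm: ?meas unfolding R_def by measurable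
  note [measurable] = Rm
  let ?T = "\<Sum>l. (cmod (c (l + N)))\<^sup>2"
  have cN: "summable (\<lambda>l. (cmod (c (l + N)))\<^sup>2)"
    using c by (subst summable_iff_shift)
  have T: "0 \<le> ?T" by (rule suminf_nonneg[OF cN]) simp
  have Rlim: "(\<lambda>m. \<Sum>l\<in>{N..<N+m}. c l * e l x) \<longlonglongrightarrow> R N x" for x
  proof -
    have "(\<lambda>m. (\<Sum>l<N+m. c l * e l x) - (\<Sum>l<N. c l * e l x)) \<longlonglongrightarrow> R N x"
      unfolding R_def using LIMSEQ_ignore_initial_segment[OF lim[of x], of N]
      by (intro tendsto_diff tendsto_const) (simp add: add.commute)
    moreover have "(\<Sum>l<N+m. c l * e l x) - (\<Sum>l<N. c l * e l x) = (\<Sum>l\<in>{N..<N+m}. c l * e l x)" for m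
      using sum_diff_nat_ivl[of 0 N "N + m" "\<lambda>l. c l * e l x"] by (simp add: lessThan_atLeast0)
    ultimately show ?thesis by simp
  qed
  \<comment> \<open>The finite blocks of terms from N on converge pointwise to the remainder. By
    orthonormality their squared norms are partial sums of the tail, hence bounded by
    \<open>?T\<close> uniformly in m.\<close>
  have "(\<integral>\<^sup>+x. ennreal ((cmod (R N x))\<^sup>2) \<partial>M)
      = (\<integral>\<^sup>+x. liminf (\<lambda>m. ennreal ((cmod (\<Sum>l\<in>{N..<N+m}. c l * e l x))\<^sup>2)) \<partial>M)"
  proof (rule nn_integral_cong)
    fix x
    have "(\<lambda>m. ennreal ((cmod (\<Sum>l\<in>{N..<N+m}. c l * e l x))\<^sup>2)) \<longlonglongrightarrow> ennreal ((cmod (R N x))\<^sup>2)"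
      by (intro tendsto_ennrealI tendsto_power tendsto_norm Rlim)
    then show "ennreal ((cmod (R N x))\<^sup>2) = liminf (\<lambda>m. ennreal ((cmod (\<Sum>l\<in>{N..<N+m}. c l * e l x))\<^sup>2))"
      by (intro lim_imp_Liminf[symmetric]) auto
  qed
  also have "\<dots> \<le> liminf (\<lambda>m. \<integral>\<^sup>+x. ennreal ((cmod (\<Sum>l\<in>{N..<N+m}. c l * e l x))\<^sup>2) \<partial>M)"
    by (rule nn_integral_liminf) measurable
  also have "\<dots> \<le> liminf (\<lambda>m :: nat. ennreal ?T)"
  proof (rule Liminf_mono, rule always_eventually, rule allI)
    fix m
    have "(\<integral>\<^sup>+x. ennreal ((cmod (\<Sum>l\<in>{N..<N+m}. c l * e l x))\<^sup>2) \<partial>M) = ennreal (\<Sum>l\<in>{N..<N+m}. (cmod (c l))\<^sup>2)"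
      using nn_integral_eq_integral[OF integral_norm_sum_square(1)[of "{N..<N+m}" c]]
      by (simp add: integral_norm_sum_square(2))
    also have "(\<Sum>l\<in>{N..<N+m}. (cmod (c l))\<^sup>2) = (\<Sum>l<m. (cmod (c (l + N)))\<^sup>2)"
      using sum.shift_bounds_nat_ivl[of "\<lambda>l. (cmod (c l))\<^sup>2" 0 N m] by (simp add: lessThan_atLeast0 add.commute)
    also have "ennreal \<dots> \<le> ennreal ?T"
      by (intro ennreal_leI sum_le_suminf cN) auto
    finally show "(\<integral>\<^sup>+x. ennreal ((cmod (\<Sum>l\<in>{N..<N+m}. c l * e l x))\<^sup>2) \<partial>M) \<le> ennreal ?T" .
  qed
  also have "\<dots> = ennreal ?T" by (simp add: Liminf_const)
  finally have le: "(\<integral>\<^sup>+x. ennreal ((cmod (R N x))\<^sup>2) \<partial>M) \<le> ennreal ?T" .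
  then show int: ?int
    by (intro integrableI_bounded) (auto intro: le_less_trans[OF _ ennreal_less_top])
  show ?le
    using le T nn_integral_eq_integral[OF int] by (simp add: ennreal_le_iff)
qed

text \<open>Two telescoping replacements lead from f and g to their partial sums. Finite
  orthonormality evaluates the product of the partial sums, and Cauchy-Schwarz bounds each
  replacement error by a tail norm times a full norm.\<close>

lemma parseval:
  fixes c d :: "nat \<Rightarrow> complex"
  assumes c: "summable (\<lambda>l. (cmod (c l))\<^sup>2)" and d: "summable (\<lambda>l. (cmod (d l))\<^sup>2)"
    and f: "\<And>x. (\<lambda>l. c l * e l x) sums f x" and g: "\<And>x. (\<lambda>l. d l * e l x) sums g x"
  shows "(\<lambda>l. c l * cnj (d l)) sums (LINT x|M. f x * cnj (g x))"
proof -
  define t where "t c N = sqrt (\<Sum>l. (cmod (c (l + N)))\<^sup>2)" for c :: "nat \<Rightarrow> complex" and N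
  define S where "S c N x = (\<Sum>l<N. c l * e l x)" for c N x
  have t_lim: "t c \<longlonglongrightarrow> 0" if "summable (\<lambda>l. (cmod (c l))\<^sup>2)" for c
    using tendsto_real_sqrt[OF suminf_exist_split2[OF that]] by (simp add: t_def[abs_def])
  \<comment> \<open>The bounds on f itself are the remainder estimate for N = 0, where the
    subtracted partial sum is empty.\<close>
  have bound: "f \<in> borel_measurable M \<and> integrable M (\<lambda>x. (cmod (f x))\<^sup>2) \<and>
      sqrt (LINT x|M. (cmod (f x))\<^sup>2) \<le> t c 0 \<and>
      (\<forall>N. (\<lambda>x. f x - S c N x) \<in> borel_measurable M \<and>
           integrable M (\<lambda>x. (cmod (f x - S c N x))\<^sup>2) \<and>
           sqrt (LINT x|M. (cmod (f x - S c N x))\<^sup>2) \<le> t c N)"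
    if "summable (\<lambda>l. (cmod (c l))\<^sup>2)" "\<And>x. (\<lambda>l. c l * e l x) sums f x" for c f
    using integral_norm_remainder_square_le[OF that] integral_norm_remainder_square_le[OF that, of 0]
    unfolding S_def t_def by (auto intro!: real_sqrt_le_mono)
  note bf = bound[OF c f] and bg = bound[OF d g]
  have S_meas: "S c N \<in> borel_measurable M" for c N unfolding S_def by measurable
  have S_int: "integrable M (\<lambda>x. (cmod (S c N x))\<^sup>2)" for c N
    unfolding S_def by (rule integral_norm_sum_square) simp
  have S_le: "sqrt (LINT x|M. (cmod (S c N x))\<^sup>2) \<le> t c 0" if "summable (\<lambda>l. (cmod (c l))\<^sup>2)" for c N
    unfolding S_def t_def using that
    by (subst integral_norm_sum_square) (auto intro!: real_sqrt_le_mono sum_le_suminf)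
  have t_nonneg: "0 \<le> t c N" if "summable (\<lambda>l. (cmod (c l))\<^sup>2)" for c N
    unfolding t_def using summable_ignore_initial_segment[OF that]
    by (auto intro!: suminf_nonneg)
  let ?I = "LINT x|M. f x * cnj (g x)"
  have diff: "cmod (?I - (\<Sum>l<N. c l * cnj (d l))) \<le> t c N * t d 0 + t c 0 * t d N" for N
  proof -
    let ?P = "LINT x|M. (f x - S c N x) * cnj (g x)" and ?Q = "LINT x|M. S c N x * cnj (g x - S d N x)"
    have intP: "integrable M (\<lambda>x. (f x - S c N x) * cnj (g x))"
      using bf bg by (intro integrable_mult_cnj) auto
    have intQ: "integrable M (\<lambda>x. S c N x * cnj (g x - S d N x))"
      using bg S_meas S_int by (intro integrable_mult_cnj) auto
    have intS: "integrable M (\<lambda>x. S c N x * cnj (S d N x))"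
      unfolding S_def by (rule integral_sum_mult_cnj_sum) simp
    have "?I = (LINT x|M. ((f x - S c N x) * cnj (g x) + S c N x * cnj (g x - S d N x)) + S c N x * cnj (S d N x))"
      by (simp add: algebra_simps)
    also have "\<dots> = ?P + ?Q + (LINT x|M. S c N x * cnj (S d N x))"
      using intP intQ intS by (subst Bochner_Integration.integral_add; simp?)+
    also have "(LINT x|M. S c N x * cnj (S d N x)) = (\<Sum>l<N. c l * cnj (d l))"
      unfolding S_def by (rule integral_sum_mult_cnj_sum) simp
    finally have "cmod (?I - (\<Sum>l<N. c l * cnj (d l))) \<le> cmod ?P + cmod ?Q"
      by (simp add: norm_triangle_ineq)
    also have "cmod ?P \<le> sqrt (LINT x|M. (cmod (f x - S c N x))\<^sup>2) * sqrt (LINT x|M. (cmod (g x))\<^sup>2)"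
      using bf bg by (intro norm_integral_mult_cnj_le) auto
    also have "\<dots> \<le> t c N * t d 0"
      using bf bg t_nonneg[OF c] by (intro mult_mono) (auto intro!: Bochner_Integration.integral_nonneg)
    also have "cmod ?Q \<le> sqrt (LINT x|M. (cmod (S c N x))\<^sup>2) * sqrt (LINT x|M. (cmod (g x - S d N x))\<^sup>2)"
      using bg S_meas S_int by (intro norm_integral_mult_cnj_le) auto
    also have "\<dots> \<le> t c 0 * t d N"
      using bg S_le[OF c] t_nonneg[OF c] by (intro mult_mono) (auto intro!: Bochner_Integration.integral_nonneg)
    finally show ?thesis by simp
  qed
  have "(\<lambda>N. t c N * t d 0 + t c 0 * t d N) \<longlonglongrightarrow> 0 * t d 0 + t c 0 * 0"
    by (intro tendsto_intros t_lim c d)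
  then have "(\<lambda>N. t c N * t d 0 + t c 0 * t d N) \<longlonglongrightarrow> 0" by simp
  from Lim_null_comparison[OF always_eventually[rule_format, OF diff] this]
  have "(\<lambda>N. ?I - (\<Sum>l<N. c l * cnj (d l))) \<longlonglongrightarrow> 0" .
  from tendsto_diff[OF tendsto_const[of ?I] this] show ?thesis by (simp add: sums_def)
qed

end

section \<open>Holomorphy of square summable series of monomials\<close>

lemma holomorphic_l2_monomial_series:
  fixes a :: "nat \<Rightarrow> complex" and m :: "nat \<Rightarrow> nat"
  assumes e: "\<And>z. summable (\<lambda>l. (cmod (a l * z ^ m l))\<^sup>2)"
    and f: "f \<in> l2_series_space (\<lambda>l z. a l * z ^ m l)"
  shows "f holomorphic_on UNIV"
proof -
  obtain c where c: "summable (\<lambda>l. (cmod (c l))\<^sup>2)" and cf: "\<And>z. (\<lambda>l. c l * (a l * z ^ m l)) sums f z"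
    using f by (auto simp: l2_series_space_def)
  have "\<exists>d h. 0 < d \<and> summable h \<and> range h \<subseteq> \<real>\<^sub>\<ge>\<^sub>0 \<and>
      (\<forall>\<^sub>F n in sequentially. \<forall>y\<in>ball z d \<inter> UNIV. cmod (c n * (a n * y ^ m n)) \<le> cmod (h n))" for z
  proof -
    \<comment> \<open>The modulus of a monomial grows with that of its argument, so square
      summability at the single point \<open>r\<close> dominates the series on the whole unit ball
      around z.\<close>
    define r where "r = complex_of_real (cmod z + 1)"
    define h where "h n = (cmod (c n))\<^sup>2 + (cmod (a n * r ^ m n))\<^sup>2" for n
    have "summable h" unfolding h_def by (intro summable_add c e)
    then have "summable (\<lambda>n. complex_of_real (h n))" by (rule summable_of_real)
    moreover have h: "0 \<le> h n" for n by (simp add: h_def)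
    moreover have "cmod (c n * (a n * y ^ m n)) \<le> h n" if "y \<in> ball z 1" for n y
    proof -
      have "cmod y \<le> cmod r"
        using that norm_triangle_ineq2[of y z] by (simp add: r_def dist_norm norm_minus_commute del: of_real_add)
      then have "cmod (a n * y ^ m n) \<le> cmod (a n * r ^ m n)"
        by (simp add: norm_mult norm_power mult_left_mono power_mono)
      then have "cmod (c n) * cmod (a n * y ^ m n) \<le> cmod (c n) * cmod (a n * r ^ m n)"
        by (rule mult_left_mono) simp
      also have "\<dots> \<le> h n" unfolding h_def by (rule mult_le_sum_squares)
      finally show ?thesis by (simp add: norm_mult)
    qed
    ultimately show ?thesis
      by (intro exI[of _ 1] exI[of _ "\<lambda>n. complex_of_real (h n)"]) auto
  qed
  note bound = this
  have diff: "(\<lambda>z. c l * (a l * z ^ m l)) field_differentiable at z" for l z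
    by (intro field_differentiable_mult field_differentiable_power field_differentiable_const
        field_differentiable_ident)
  obtain g where g: "\<forall>z\<in>UNIV. (\<lambda>l. c l * (a l * z ^ m l)) sums g z \<and> g field_differentiable at z"
    by (rule series_differentiable_comparison_complex[OF open_UNIV diff bound])
  have "f = g" using cf g by (auto intro: sums_unique2)
  then show ?thesis using g by (simp add: holomorphic_on_def field_differentiable_at_within)
qed

section \<open>Radial weights\<close>

lemma has_bochner_integral_radial:
  fixes h :: "real \<Rightarrow> real"
  assumes [measurable]: "h \<in> borel_measurable borel"
    and h: "has_bochner_integral lborel (\<lambda>u. indicator {0..} u * h u) b"
  shows "has_bochner_integral lborel (\<lambda>z :: complex. h ((cmod z)\<^sup>2)) (pi * b)"
proof -
  have "has_bochner_integral lborel (\<lambda>u. (pi * indicator {0..} u) *\<^sub>R h u) (pi * b)"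
    using has_bochner_integral_mult_right[of pi, OF h] by (simp add: mult.assoc)
  then have "has_bochner_integral (density lborel (\<lambda>u. ennreal (pi * indicator {0..} u))) h (pi * b)"
    by (intro has_bochner_integral_density) auto
  then have "has_bochner_integral (distr lborel borel (\<lambda>z. (cmod z)\<^sup>2)) h (pi * b)"
    by (simp only: distr_lborel_cmod_square)
  then show ?thesis
    by (simp add: has_bochner_integral_iff integrable_distr_eq integral_distr)
qed

text \<open>Rotation by the angle pi / (p - q) multiplies the integrand by -1 and preserves Lebesgue
  measure, so the integral equals its own negative.\<close>

lemma integral_radial_monomials_eq_0:
  fixes w :: "real \<Rightarrow> real"
  assumes pq: "p \<noteq> q"
  shows "(LINT z|lborel. z ^ p * cnj (z ^ q) * complex_of_real (w (cmod z))) = 0"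
proof (cases "(\<lambda>z. z ^ p * cnj (z ^ q) * complex_of_real (w (cmod z))) \<in> borel_measurable borel")
  case True
  define t where "t = pi / (real p - real q)"
  define r where "r = cis t"
  let ?h = "\<lambda>z. z ^ p * cnj (z ^ q) * complex_of_real (w (cmod z))"
  let ?I = "LINT z|lborel. ?h z"
  have r: "cmod r = 1" by (simp add: r_def)
  have "r ^ p * cnj (r ^ q) = cis (real p * t + - (real q * t))"
    by (simp only: r_def Complex.DeMoivre cis_cnj cis_mult)
  also have "real p * t + - (real q * t) = (real p - real q) * t"
    by (simp add: left_diff_distrib)
  also have "\<dots> = pi" using pq by (simp add: t_def)
  also have "cis pi = -1" by simp
  finally have rpq: "r ^ p * cnj (r ^ q) = -1" .
  have "?I = (LINT z|distr lborel borel ((*) r). ?h z)"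
    by (simp only: distr_lborel_complex_rotation[OF r])
  also have "\<dots> = (LINT z|lborel. ?h (r * z))"
    using True by (intro integral_distr) auto
  also have "\<dots> = (LINT z|lborel. (r ^ p * cnj (r ^ q)) * ?h z)"
    by (simp add: power_mult_distrib norm_mult r mult_ac)
  also have "\<dots> = - ?I" unfolding rpq by simp
  finally show ?thesis by simp
next
  \<comment> \<open>A function that is not measurable is not integrable, and its integral is 0 by
    convention.\<close>
  case False
  then show ?thesis
    by (intro not_integrable_integral_eq) (auto dest: borel_measurable_integrable)
qed

text \<open>The moments \<open>b l\<close> are taken in the squared modulus, whose distribution
  contributes the factor pi in \<open>norm\<close>; thus \<open>norm\<close> says that each
  monomial, scaled by \<open>a l\<close>, has norm 1. Distinct degrees give orthogonality. Absorbing
  the weight into the measure turns \<open>ip\<close> into a plain integral of products, to which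
  the orthonormal series apply.\<close>

lemma radial_monomials_rkhs:
  fixes w :: "real \<Rightarrow> real" and a :: "nat \<Rightarrow> real" and m :: "nat \<Rightarrow> nat"
  assumes w [measurable]: "w \<in> borel_measurable borel" and w_nonneg: "\<And>u. 0 \<le> w u"
    and inj: "inj m"
    and moment: "\<And>l. has_bochner_integral lborel (\<lambda>u. indicator {0..} u * (u ^ m l * w u)) (b l)"
    and norm: "\<And>l. pi * b l * (a l)\<^sup>2 = 1"
    and summ: "\<And>z :: complex. summable (\<lambda>l. (cmod (complex_of_real (a l) * z ^ m l))\<^sup>2)"
  defines "e \<equiv> \<lambda>l z. complex_of_real (a l) * z ^ m l" and "ip \<equiv> weighted_ip (\<lambda>z. w ((cmod z)\<^sup>2))"
  shows "(\<forall>f\<in>l2_series_space e. f holomorphic_on UNIV) \<and> rkhs (l2_series_space e) ip \<and>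
    (\<forall>z w. summable (\<lambda>l. e l z * cnj (e l w))) \<and>
    reproducing_kernel (l2_series_space e) ip (\<lambda>w z. \<Sum>l. e l z * cnj (e l w))"
proof -
  let ?\<rho> = "\<lambda>z :: complex. w ((cmod z)\<^sup>2)"
  let ?M = "density lborel (\<lambda>z. ennreal (?\<rho> z))"
  have ip_eq: "ip f g = (LINT z|?M. f z * cnj (g z))"
    if [measurable]: "f \<in> borel_measurable borel" "g \<in> borel_measurable borel" for f g
  proof -
    have "(LINT z|?M. f z * cnj (g z)) = (LINT z|lborel. ?\<rho> z *\<^sub>R (f z * cnj (g z)))"
      by (rule integral_density) (auto simp: w_nonneg)
    then show ?thesis by (simp add: ip_def weighted_ip_def scaleR_conv_of_real mult_ac)
  qed
  have e_meas [measurable]: "e l \<in> borel_measurable borel" for l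
    unfolding e_def by measurable
  have sq: "has_bochner_integral lborel (\<lambda>z. ?\<rho> z * (cmod (e l z))\<^sup>2) 1" for l
  proof -
    have "has_bochner_integral lborel (\<lambda>z :: complex. ((cmod z)\<^sup>2) ^ m l * w ((cmod z)\<^sup>2)) (pi * b l)"
      using moment by (intro has_bochner_integral_radial) auto
    then have "has_bochner_integral lborel
        (\<lambda>z :: complex. ((cmod z)\<^sup>2) ^ m l * w ((cmod z)\<^sup>2) * (a l)\<^sup>2) (pi * b l * (a l)\<^sup>2)"
      by (rule has_bochner_integral_mult_left)
    moreover have "((cmod z)\<^sup>2) ^ m l * w ((cmod z)\<^sup>2) * (a l)\<^sup>2 = ?\<rho> z * (cmod (e l z))\<^sup>2" for z
      by (simp add: e_def norm_mult norm_power power_mult_distrib power_mult[symmetric] mult_ac)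
    ultimately show ?thesis by (simp add: norm)
  qed
  interpret orthonormal_functions ?M e
  proof
    show "e l \<in> borel_measurable ?M" for l by simp
    show "integrable ?M (\<lambda>z. (cmod (e l z))\<^sup>2)" for l
      using sq[of l] w_nonneg by (subst integrable_density) (auto simp: has_bochner_integral_iff)
    show "(LINT z|?M. e k z * cnj (e l z)) = (if k = l then 1 else 0)" for k l
    proof (cases "k = l")
      case True
      have "(LINT z|?M. e k z * cnj (e k z)) = (LINT z|lborel. complex_of_real (?\<rho> z * (cmod (e k z))\<^sup>2))"
        unfolding ip_eq[OF e_meas e_meas, symmetric] ip_def weighted_ip_def of_real_mult complex_norm_square
        by (simp add: mult_ac)
      also have "\<dots> = complex_of_real (LINT z|lborel. ?\<rho> z * (cmod (e k z))\<^sup>2)"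
        using sq[of k] by (intro integral_of_real) (simp add: has_bochner_integral_iff)
      also have "\<dots> = 1" using sq[of k] by (simp add: has_bochner_integral_iff)
      finally show ?thesis using True by simp
    next
      case False
      then have "m k \<noteq> m l" using inj by (auto dest: injD)
      from integral_radial_monomials_eq_0[OF this, of "\<lambda>x. w (x\<^sup>2)"]
      have "(LINT z|lborel. complex_of_real (a k * a l) * (z ^ m k * cnj (z ^ m l) * complex_of_real (?\<rho> z))) = 0"
        by (subst integral_mult_right_zero) simp
      then have "ip (e k) (e l) = 0"
        by (simp add: ip_def weighted_ip_def e_def mult_ac)
      then show ?thesis using False by (simp add: ip_eq)
    qed
  qed
  have e_summ: "summable (\<lambda>l. (cmod (e l z))\<^sup>2)" for z unfolding e_def by (rule summ)
  have pars: "(\<lambda>l. c l * cnj (d l)) sums ip f g"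
    if "summable (\<lambda>l. (cmod (c l))\<^sup>2)" "summable (\<lambda>l. (cmod (d l))\<^sup>2)"
      "\<forall>z. (\<lambda>l. c l * e l z) sums f z" "\<forall>z. (\<lambda>l. d l * e l z) sums g z" for c d f g
  proof -
    \<comment> \<open>Moving the weight from integrand to measure requires measurable functions;
      elements of the space have this property as pointwise limits of partial sums.\<close>
    have meas: "h \<in> borel_measurable borel" if "\<And>z. (\<lambda>l. k l * e l z) sums h z" for k h
      by (rule borel_measurable_LIMSEQ_metric[OF _ that[unfolded sums_def]]) measurable
    have "ip f g = (LINT z|?M. f z * cnj (g z))"
      by (rule ip_eq[OF meas[OF that(3)[rule_format]] meas[OF that(4)[rule_format]]])
    then show ?thesis using parseval[OF that(1,2) that(3,4)[rule_format]] by (simp only:)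
  qed
  have "\<forall>f\<in>l2_series_space e. f holomorphic_on UNIV"
    using holomorphic_l2_monomial_series[OF summ] unfolding e_def by (intro ballI)
  moreover have "rkhs (l2_series_space e) ip"
    by (rule rkhs_l2_series_space(1)[OF e_summ pars])
  moreover have "summable (\<lambda>l. e l z * cnj (e l w))" for z w
    by (rule rkhs_l2_series_space(2)[OF e_summ pars])
  moreover have "reproducing_kernel (l2_series_space e) ip (\<lambda>w z. \<Sum>l. e l z * cnj (e l w))"
    by (rule rkhs_l2_series_space(3)[OF e_summ pars])
  ultimately show ?thesis by (intro conjI allI)
qed

section \<open>The Bessel weights\<close>

text \<open>Here \<alpha> and \<beta> are the two Mellin parameters. Assumption \<open>m\<close>
  equates the exponent m + n - 1/2 of u in monomial and weight with n (\<alpha> + \<beta>) - 1. In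
  the coefficient, the power of 2n is the one in the moment divided by the one in the weight; the
  factors 2 and pi of the weight cancel against the 1/2 of the moment and the pi of the
  area.\<close>

lemma bessel_weight_rkhs:
  fixes n :: nat and \<nu> :: real and \<alpha> \<beta> :: "nat \<Rightarrow> real" and m :: "nat \<Rightarrow> nat"
  assumes n: "n \<ge> 1" and pos: "\<And>l. 0 < \<alpha> l" "\<And>l. 0 < \<beta> l"
    and diff: "\<And>l. \<alpha> l - \<beta> l = \<nu>" and m: "\<And>l. real n * (\<alpha> l + \<beta> l) = real (m l) + real n + 1 / 2"
    and inj: "inj m"
  defines "\<rho> \<equiv> \<lambda>z. 2 / ((2 * real n) powr (1 / (2 * real n)) * pi * Gamma (1 / (2 * real n)))
      * ((cmod z)\<^sup>2) powr (real n - 1 / 2) * bessel_K \<nu> (((cmod z)\<^sup>2) ^ n / real n)"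
    and "e \<equiv> \<lambda>l z. complex_of_real (sqrt (Gamma (1 / (2 * real n)) /
      ((2 * real n) powr (\<alpha> l + \<beta> l - 1 - 1 / (2 * real n)) * Gamma (\<alpha> l) * Gamma (\<beta> l)))) * z ^ m l"
  assumes summ: "\<And>z. summable (\<lambda>l. (cmod (e l z))\<^sup>2)"
  shows "(\<forall>f\<in>l2_series_space e. f holomorphic_on UNIV) \<and> rkhs (l2_series_space e) (weighted_ip \<rho>) \<and>
    (\<forall>z w. summable (\<lambda>l. e l z * cnj (e l w))) \<and>
    reproducing_kernel (l2_series_space e) (weighted_ip \<rho>) (\<lambda>w z. \<Sum>l. e l z * cnj (e l w))"
proof -
  define C where "C = 2 / ((2 * real n) powr (1 / (2 * real n)) * pi * Gamma (1 / (2 * real n)))"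
  have G: "Gamma (1 / (2 * real n)) > 0" using n by (intro Gamma_real_pos) simp
  have C: "C > 0" using n G by (simp add: C_def)
  define w where "w u = C * u powr (real n - 1 / 2) * bessel_K \<nu> (u ^ n / real n)" for u
  define b where "b l = C * ((2 * real n) powr (\<alpha> l + \<beta> l - 1) * Gamma (\<alpha> l) * Gamma (\<beta> l) / 2)" for l
  have \<rho>: "\<rho> = (\<lambda>z. w ((cmod z)\<^sup>2))"
    by (simp add: \<rho>_def w_def C_def)
  have moment: "has_bochner_integral lborel (\<lambda>u. indicator {0..} u * (u ^ m l * w u)) (b l)" for l
  proof -
    have "has_bochner_integral lborel (\<lambda>u. C * (indicator {0<..} u *
        (u powr (real n * (\<alpha> l + \<beta> l) - 1) * bessel_K (\<alpha> l - \<beta> l) (u ^ n / real n)))) (b l)"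
      unfolding b_def using pos n by (intro has_bochner_integral_mult_right bessel_K_power_mellin)
    moreover have "C * (indicator {0<..} u *
        (u powr (real n * (\<alpha> l + \<beta> l) - 1) * bessel_K (\<alpha> l - \<beta> l) (u ^ n / real n)))
        = indicator {0..} u * (u ^ m l * w u)" for u
    proof (cases "u > 0")
      case True
      then have "u ^ m l * u powr (real n - 1 / 2) = u powr (real n * (\<alpha> l + \<beta> l) - 1)"
        unfolding m by (simp add: powr_realpow[symmetric] powr_add[symmetric] add_diff_eq)
      then show ?thesis using True by (simp add: w_def diff mult_ac)
    next
      \<comment> \<open>Since \<open>0 powr x\<close> is 0, the weight vanishes at 0, so the open
        and the closed half line give the same integrand.\<close>
      case False
      then show ?thesis by (cases "u = 0") (auto simp: w_def)
    qed
    ultimately show ?thesis by simp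
  qed
  have norm: "pi * b l * (sqrt (Gamma (1 / (2 * real n)) /
      ((2 * real n) powr (\<alpha> l + \<beta> l - 1 - 1 / (2 * real n)) * Gamma (\<alpha> l) * Gamma (\<beta> l))))\<^sup>2 = 1" for l
  proof -
    have Gp: "Gamma (\<alpha> l) > 0" "Gamma (\<beta> l) > 0" using pos by (auto intro: Gamma_real_pos)
    have p: "(2 * real n) powr (\<alpha> l + \<beta> l - 1 - 1 / (2 * real n))
        = (2 * real n) powr (\<alpha> l + \<beta> l - 1) / (2 * real n) powr (1 / (2 * real n))"
      by (rule powr_diff)
    have cancel: "pi * (2 / (y * pi * g) * (x * c * d / 2)) * (g / (x / y * c * d)) = 1"
      if "x > 0" "y > 0" "c > 0" "d > 0" "g > 0" for x y c d g :: real
      using that by (simp add: field_simps)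
    have nonneg: "0 \<le> Gamma (1 / (2 * real n)) / ((2 * real n) powr (\<alpha> l + \<beta> l - 1) /
        (2 * real n) powr (1 / (2 * real n)) * Gamma (\<alpha> l) * Gamma (\<beta> l))"
      using G Gp by simp
    show ?thesis
      unfolding b_def C_def p real_sqrt_pow2[OF nonneg]
      using n G Gp by (intro cancel) auto
  qed
  show ?thesis
    unfolding \<rho> e_def
  proof (rule radial_monomials_rkhs[OF _ _ inj moment norm])
    show "w \<in> borel_measurable borel" unfolding w_def by measurable
    show "0 \<le> w u" for u using C by (simp add: w_def bessel_K_nonneg)
  qed (use summ in \<open>simp add: e_def\<close>)
qed

section \<open>Square summability of the basis functions at a point\<close>

lemma summable_power_div_Gamma_fact:
  fixes x s :: real
  assumes x: "x \<ge> 0" and s: "s > 0"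
  shows "summable (\<lambda>k. x ^ k / (Gamma (real k + s) * fact k))"
proof -
  \<comment> \<open>For s < 1 the first recurrence step multiplies Gamma by s and lowers it; every
    later factor k + s is at least 1. The first two values therefore bound all of them from below,
    and the exponential series dominates.\<close>
  define c where "c = min (Gamma s) (Gamma (1 + s))"
  have c: "c > 0" using s by (simp add: c_def Gamma_real_pos)
  have ge: "c \<le> Gamma (real k + s)" for k
  proof (induction k)
    case (Suc k)
    show ?case
    proof (cases k)
      case (Suc j)
      have "c \<le> 1 * Gamma (real k + s)" using Suc.IH by simp
      also have "\<dots> \<le> (real k + s) * Gamma (real k + s)"
        using Suc s by (intro mult_right_mono) (auto intro!: less_imp_le Gamma_real_pos)
      also have "\<dots> = Gamma (real k + s + 1)"
        using s by (intro Gamma_plus1[symmetric]) auto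
      finally show ?thesis by (simp add: add_ac)
    qed (simp add: c_def)
  qed (simp add: c_def)
  show ?thesis
  proof (rule summable_comparison_test')
    show "summable (\<lambda>k. 1 / c * (inverse (fact k) * x ^ k))"
      by (intro summable_mult summable_exp)
    fix k
    have "Gamma (real k + s) > 0" using s by (intro Gamma_real_pos) simp
    then have "x ^ k / (Gamma (real k + s) * fact k) \<le> x ^ k / (c * fact k)"
      using x c ge[of k] by (intro divide_left_mono mult_right_mono mult_pos_pos) auto
    then show "norm (x ^ k / (Gamma (real k + s) * fact k)) \<le> 1 / c * (inverse (fact k) * x ^ k)"
      using x \<open>Gamma (real k + s) > 0\<close> by (simp add: field_simps)
  qed
qed

text \<open>Common shape of the even and odd halves of both bases: up to a factor independent of k,
  the squared terms form a series in powers of (|z|^q / N)^2 with coefficients 1 / (Gamma (k + s)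
  k!).\<close>

lemma summable_norm_monomials:
  fixes z :: complex and G N s p :: real
  assumes G: "G \<ge> 0" and N: "N > 0" and s: "s > 0"
  shows "summable (\<lambda>k. (cmod (complex_of_real (sqrt (G / (N powr (2 * real k + p) *
            Gamma (real k + s) * fact k))) * z ^ (q * k + d)))\<^sup>2)"
proof -
  let ?x = "(cmod z ^ q / N)\<^sup>2"
  have "(cmod (complex_of_real (sqrt (G / (N powr (2 * real k + p) * Gamma (real k + s) * fact k))) * z ^ (q * k + d)))\<^sup>2
      = G * (cmod z ^ d)\<^sup>2 / N powr p * (?x ^ k / (Gamma (real k + s) * fact k))" for k
  proof -
    have "Gamma (real k + s) > 0" using s by (intro Gamma_real_pos) simp
    then have "(sqrt (G / (N powr (2 * real k + p) * Gamma (real k + s) * fact k)))\<^sup>2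
        = G / (N powr (2 * real k + p) * Gamma (real k + s) * fact k)"
      using G N by simp
    moreover have "N powr (2 * real k + p) = (N\<^sup>2) ^ k * N powr p"
      using N powr_realpow[of N "2 * k"] by (simp add: powr_add power_mult)
    moreover have "(cmod z ^ (q * k + d))\<^sup>2 = ((cmod z ^ q)\<^sup>2) ^ k * (cmod z ^ d)\<^sup>2"
      by (simp add: power_add power_mult_distrib power_mult[symmetric] mult_ac)
    ultimately show ?thesis
      by (simp add: norm_mult norm_power power_mult_distrib power_divide mult_ac)
  qed
  then show ?thesis
    using s by (simp only:) (intro summable_mult summable_power_div_Gamma_fact, auto)
qed

lemma summable_even_odd:
  fixes f :: "nat \<Rightarrow> real"
  assumes even: "summable (\<lambda>k. f (2 * k))" and odd: "summable (\<lambda>k. f (2 * k + 1))"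
  shows "summable f"
proof -
  have "(\<lambda>l. if even l then f (2 * (l div 2)) else f (2 * ((l - 1) div 2) + 1)) = f"
    by (auto simp: fun_eq_iff elim!: oddE)
  then show ?thesis
    using sums_if[OF summable_sums[OF odd] summable_sums[OF even]] by (auto simp: sums_iff)
qed

theorem theorem3p8:
  fixes n :: nat
  assumes "n \<ge> 1"
  shows "(\<forall>f\<in>F1 n. f holomorphic_on UNIV) \<and>
         rkhs (F1 n) (weighted_ip (rho1 n)) \<and>
         (\<forall>z w. summable (\<lambda>l. e_fun n l z * cnj (e_fun n l w))) \<and>
         reproducing_kernel (F1 n) (weighted_ip (rho1 n))
           (\<lambda>w z. \<Sum>l. e_fun n l z * cnj (e_fun n l w)) \<and>
         (\<forall>f\<in>F2 n. f holomorphic_on UNIV) \<and>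
         rkhs (F2 n) (weighted_ip (rho2 n)) \<and>
         (\<forall>z w. summable (\<lambda>l. et_fun n l z * cnj (et_fun n l w))) \<and>
         reproducing_kernel (F2 n) (weighted_ip (rho2 n))
           (\<lambda>w z. \<Sum>l. et_fun n l z * cnj (et_fun n l w))"
proof -
  define s where "s = 1 / (2 * real n)"
  have n: "real n \<ge> 1" using assms by simp
  have s: "0 < s" "s < 1" using n by (auto simp: s_def)
  have ns: "real n * s = 1 / 2" "1 / real n = 2 * s" using n by (auto simp: s_def)
  have N: "2 * real n > 0" and G: "Gamma s \<ge> 0"
    using n s by (auto intro: less_imp_le Gamma_real_pos)
  \<comment> \<open>The definitions of the bases mix natural and real powers of 2n, while the
    general statement uses only \<open>powr\<close>.\<close>
  have rp: "(2 * real n) ^ j = (2 * real n) powr real j" for j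
    using n by (simp add: powr_realpow)

  \<comment> \<open>With k = l div 2, one parameter is k + 1, which yields the factor k!, and the
    other is placed so that \<alpha> - \<beta> is the order 1 - s. For even l this is \<alpha> = k +
    1, for odd l it is \<beta> = k + 1; the sums give the degrees 2nk and 2nk + 2n - 1.\<close>
  define \<alpha>1 where "\<alpha>1 l = real (l div 2) + (if even l then 1 else 2 - s)" for l :: nat
  define \<beta>1 where "\<beta>1 l = real (l div 2) + (if even l then s else 1)" for l :: nat
  define m1 where "m1 l = 2 * n * (l div 2) + (if even l then 0 else 2 * n - 1)" for l
  have e1: "e_fun n = (\<lambda>l z. complex_of_real (sqrt (Gamma (1 / (2 * real n)) /
      ((2 * real n) powr (\<alpha>1 l + \<beta>1 l - 1 - 1 / (2 * real n)) * Gamma (\<alpha>1 l) * Gamma (\<beta>1 l)))) * z ^ m1 l)"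
    unfolding s_def[symmetric]
  proof (intro ext)
    fix l z
    show "e_fun n l z = complex_of_real (sqrt (Gamma s / ((2 * real n) powr (\<alpha>1 l + \<beta>1 l - 1 - s)
        * Gamma (\<alpha>1 l) * Gamma (\<beta>1 l)))) * z ^ m1 l"
    proof (cases "even l")
      case True
      have ex: "\<alpha>1 l + \<beta>1 l - 1 - s = 2 * real (l div 2)"
        using True by (simp add: \<alpha>1_def \<beta>1_def)
      have fct: "Gamma (\<alpha>1 l) = fact (l div 2)"
        using True by (simp add: \<alpha>1_def Gamma_fact[symmetric] add.commute)
      show ?thesis
        unfolding e_fun_def Let_def s_def[symmetric] ex fct rp of_nat_mult of_nat_add of_nat_numeral of_nat_1 ns(2)
        using True assms
        by (simp add: \<beta>1_def m1_def add_diff_eq add.assoc mult.commute mult.left_commute)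
    next
      case False
      have ex: "\<alpha>1 l + \<beta>1 l - 1 - s = 2 * real (l div 2) + 2 - 2 * s"
        using False by (simp add: \<alpha>1_def \<beta>1_def)
      have fct: "Gamma (\<beta>1 l) = fact (l div 2)"
        using False by (simp add: \<beta>1_def Gamma_fact[symmetric] add.commute)
      show ?thesis
        unfolding e_fun_def Let_def s_def[symmetric] ex fct rp of_nat_mult of_nat_add of_nat_numeral of_nat_1 ns(2)
        using False assms
        by (simp add: \<alpha>1_def m1_def add_diff_eq add.assoc mult.commute mult.left_commute)
    qed
  qed
  have sum1: "summable (\<lambda>l. (cmod (e_fun n l z))\<^sup>2)" for z
  proof (rule summable_even_odd)
    show "summable (\<lambda>k. (cmod (e_fun n (2 * k) z))\<^sup>2)"
      using summable_norm_monomials[OF G N s(1), of 0 z "2 * n" 0]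
      unfolding e_fun_def Let_def s_def[symmetric] rp of_nat_mult of_nat_add of_nat_numeral of_nat_1 ns(2)
      by (simp add: add_diff_eq add.assoc)
    show "summable (\<lambda>k. (cmod (e_fun n (2 * k + 1) z))\<^sup>2)"
      using summable_norm_monomials[OF G N, of "2 - s" "2 - 2 * s" z "2 * n" "2 * n - 1"] s assms
      unfolding e_fun_def Let_def s_def[symmetric] rp of_nat_mult of_nat_add of_nat_numeral of_nat_1 ns(2)
      by (simp add: add_diff_eq add.assoc)
  qed
  \<comment> \<open>From even to odd index the degree grows by 2n - 1, from odd to even by
    1.\<close>
  have "m1 l < m1 (Suc l)" for l
    using assms by (cases "even l") (auto simp: m1_def elim!: evenE oddE)
  then have inj1: "inj m1"
    by (intro strict_mono_imp_inj_on strict_monoI_Suc)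
  have 1: "(\<forall>f\<in>F1 n. f holomorphic_on UNIV) \<and> rkhs (F1 n) (weighted_ip (rho1 n)) \<and>
      (\<forall>z w. summable (\<lambda>l. e_fun n l z * cnj (e_fun n l w))) \<and>
      reproducing_kernel (F1 n) (weighted_ip (rho1 n)) (\<lambda>w z. \<Sum>l. e_fun n l z * cnj (e_fun n l w))"
    unfolding F1_def rho1_def[abs_def] e1
  proof (rule bessel_weight_rkhs[OF assms _ _ _ _ inj1])
    show "0 < \<alpha>1 l" "0 < \<beta>1 l" for l
      using s by (auto simp: \<alpha>1_def \<beta>1_def intro!: add_nonneg_pos)
    show "\<alpha>1 l - \<beta>1 l = 1 - 1 / (2 * real n)" for l
      unfolding s_def[symmetric] by (simp add: \<alpha>1_def \<beta>1_def)
    show "real n * (\<alpha>1 l + \<beta>1 l) = real (m1 l) + real n + 1 / 2" for l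
      using ns(1) assms by (simp add: \<alpha>1_def \<beta>1_def m1_def of_nat_diff distrib_left right_diff_distrib)
  qed (use sum1 in \<open>simp add: e1\<close>)

  \<comment> \<open>The same placement of k + 1, now with difference s: the sums are 2k + 2 - s and
    2k + 2 + s, and n s = 1/2 turns them into the neighbouring degrees 2nk + n - 1 and 2nk +
    n.\<close>
  define \<alpha>2 where "\<alpha>2 l = real (l div 2) + (if even l then 1 else 1 + s)" for l :: nat
  define \<beta>2 where "\<beta>2 l = real (l div 2) + (if even l then 1 - s else 1)" for l :: nat
  define m2 where "m2 l = 2 * n * (l div 2) + (if even l then n - 1 else n)" for l
  have e2: "et_fun n = (\<lambda>l z. complex_of_real (sqrt (Gamma (1 / (2 * real n)) /
      ((2 * real n) powr (\<alpha>2 l + \<beta>2 l - 1 - 1 / (2 * real n)) * Gamma (\<alpha>2 l) * Gamma (\<beta>2 l)))) * z ^ m2 l)"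
    unfolding s_def[symmetric]
  proof (intro ext)
    fix l z
    show "et_fun n l z = complex_of_real (sqrt (Gamma s / ((2 * real n) powr (\<alpha>2 l + \<beta>2 l - 1 - s)
        * Gamma (\<alpha>2 l) * Gamma (\<beta>2 l)))) * z ^ m2 l"
    proof (cases "even l")
      case True
      have ex: "\<alpha>2 l + \<beta>2 l - 1 - s = 2 * real (l div 2) + 1 - 2 * s"
        using True by (simp add: \<alpha>2_def \<beta>2_def)
      have fct: "Gamma (\<alpha>2 l) = fact (l div 2)"
        using True by (simp add: \<alpha>2_def Gamma_fact[symmetric] add.commute)
      show ?thesis
        unfolding et_fun_def Let_def s_def[symmetric] ex fct rp of_nat_mult of_nat_add of_nat_numeral of_nat_1 ns(2)
        using True assms
        by (simp add: \<beta>2_def m2_def add_diff_eq add.assoc mult.commute mult.left_commute)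
    next
      case False
      have ex: "\<alpha>2 l + \<beta>2 l - 1 - s = 2 * real (l div 2) + 1"
        using False by (simp add: \<alpha>2_def \<beta>2_def)
      have fct: "Gamma (\<beta>2 l) = fact (l div 2)"
        using False by (simp add: \<beta>2_def Gamma_fact[symmetric] add.commute)
      show ?thesis
        unfolding et_fun_def Let_def s_def[symmetric] ex fct rp of_nat_mult of_nat_add of_nat_numeral of_nat_1 ns(2)
        using False assms
        by (simp add: \<alpha>2_def m2_def add_diff_eq add.assoc mult.commute mult.left_commute)
    qed
  qed
  have sum2: "summable (\<lambda>l. (cmod (et_fun n l z))\<^sup>2)" for z
  proof (rule summable_even_odd)
    show "summable (\<lambda>k. (cmod (et_fun n (2 * k) z))\<^sup>2)"
      using summable_norm_monomials[OF G N, of "1 - s" "1 - 2 * s" z "2 * n" "n - 1"] s assms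
      unfolding et_fun_def Let_def s_def[symmetric] rp of_nat_mult of_nat_add of_nat_numeral of_nat_1 ns(2)
      by (simp add: add_diff_eq add.assoc)
    show "summable (\<lambda>k. (cmod (et_fun n (2 * k + 1) z))\<^sup>2)"
      using summable_norm_monomials[OF G N, of "1 + s" 1 z "2 * n" n] s
      unfolding et_fun_def Let_def s_def[symmetric] rp of_nat_mult of_nat_add of_nat_numeral of_nat_1 ns(2)
      by (simp add: add_diff_eq add.assoc)
  qed
  have "m2 l < m2 (Suc l)" for l
    using assms by (cases "even l") (auto simp: m2_def elim!: evenE oddE)
  then have inj2: "inj m2"
    by (intro strict_mono_imp_inj_on strict_monoI_Suc)
  have 2: "(\<forall>f\<in>F2 n. f holomorphic_on UNIV) \<and> rkhs (F2 n) (weighted_ip (rho2 n)) \<and>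
      (\<forall>z w. summable (\<lambda>l. et_fun n l z * cnj (et_fun n l w))) \<and>
      reproducing_kernel (F2 n) (weighted_ip (rho2 n)) (\<lambda>w z. \<Sum>l. et_fun n l z * cnj (et_fun n l w))"
    unfolding F2_def rho2_def[abs_def] e2
  proof (rule bessel_weight_rkhs[OF assms _ _ _ _ inj2])
    show "0 < \<alpha>2 l" "0 < \<beta>2 l" for l
      using s by (auto simp: \<alpha>2_def \<beta>2_def intro!: add_nonneg_pos)
    show "\<alpha>2 l - \<beta>2 l = 1 / (2 * real n)" for l
      unfolding s_def[symmetric] by (simp add: \<alpha>2_def \<beta>2_def)
    show "real n * (\<alpha>2 l + \<beta>2 l) = real (m2 l) + real n + 1 / 2" for l
      using ns(1) assms by (simp add: \<alpha>2_def \<beta>2_def m2_def of_nat_diff distrib_left right_diff_distrib)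
  qed (use sum2 in \<open>simp add: e2\<close>)
  from 1 2 show ?thesis by blast
qed

end
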